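(* Consider a splitting method (as defined in the context) whose kernel $K$ is $V$-uniformly ergodic for some function $V$, and assume $\mu_0\{V<\infty\}=1$. Then the following three conditions are equivalent: (i) For every $\epsilon>0$, $\mathbb P\left\{\left|\frac1T\sum_{t=0}^{T-1}\sum_{i=1}^{N_t}w_t^i-1\right|>\epsilon\right\}\to 0$ as $T\to\infty$. (ii) With probability one, $\sum_{i=1}^{N_t}w_t^i=1$ for all $t\ge 0$. (iii) For every measurable $f:X\to\mathbb R$ with $\sup_x f(x)^2/V(x)<\infty$, $$\mathbb P\left\{\frac1T\sum_{t=0}^{T-1}\sum_{i=1}^{N_t}w_t^i f(\xi_t^i)\xrightarrow{T\to\infty}\mu(f)\right\}=1.$$
   Context: Splitting method: Let $K$ be a Markov transition kernel on a measurable state space $X$ and $\mu_0$ a probability distribution on $X$. A splitting method produces, for $t=0,1,2,\dots$, particles $\xi_t^1,\dots,\xi_t^{N_t}\in X$ with weights $w_t^1,\dots,w_t^{N_t}\ge 0$, together with a filtration $\mathcal F_0\subseteq\hat{\mathcal F}_0\subseteq\mathcal F_1\subseteq\hat{\mathcal F}_1\subseteq\cdots$, as follows. Initially $\xi_0^1,\dots,\xi_0^{N_0}$ are i.i.d. with law $\mu_0$ and $w_0^i=1/N_0$. At each time $t\ge 0$: (Splitting step) for each $i$ a number $C_t^i>0$ is chosen, where $(\xi_t^i,w_t^i,C_t^i)_{1\le i\le N_t}$ is $\mathcal F_t$-measurable; random nonnegative integers $N_t^i$ are drawn with $\mathbb E[N_t^i\mid\mathcal F_t]=C_t^i$; each $\xi_t^i$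 is replaced by $N_t^i$ copies, each with weight $w_t^i/C_t^i$; the resulting children are listed as $(\hat\xi_t^j,\hat w_t^j)_{1\le j\le N_{t+1}}$ with $N_{t+1}=\sum_i N_t^i$, and they are $\hat{\mathcal F}_t$-measurable. (Evolution step) conditional on $\hat{\mathcal F}_t$, the particles $\xi_{t+1}^1,\dots,\xi_{t+1}^{N_{t+1}}$ are independent with $\xi_{t+1}^j\sim K(\hat\xi_t^j,\cdot)$, and $w_{t+1}^j=\hat w_t^j$. $V$-uniform ergodicity: $K$ is $\psi$-irreducible and aperiodic with invariant probability $\mu=\mu K$; for a measurable $V:X\to[1,\infty]$ with $\mu(V)<\infty$, $K$ is $V$-uniformly ergodic if there exist $R>0$, $\rho<1$ with $\sup_{|g|\le V}|K^tg(x)-\mu(g)|\le R\rho^tV(x)$ for all $x\in X$, $t\ge0$. Here $\mu(g)=\int g\,d\mu$. *)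

theory Defs
  imports "HOL-Probability.Probability"
begin

primrec kpow :: "('a \<Rightarrow> 'a measure) \<Rightarrow> 'a measure \<Rightarrow> nat \<Rightarrow> 'a \<Rightarrow> 'a measure" where
  "kpow K X 0 = (\<lambda>x. return X x)"
| "kpow K X (Suc n) = (\<lambda>x. bind (kpow K X n x) K)"

definition psi_irreducible :: "('a \<Rightarrow> 'a measure) \<Rightarrow> 'a measure \<Rightarrow> bool" where
  "psi_irreducible K X \<longleftrightarrow>
     (\<exists>\<psi>. sets \<psi> = sets X \<and> emeasure \<psi> (space X) > 0 \<and>
        (\<forall>A\<in>sets X. emeasure \<psi> A > 0 \<longrightarrow>
           (\<forall>x\<in>space X. \<exists>n>0. emeasure (kpow K X n x) A > 0)))"

definition aperiodic :: "('a \<Rightarrow> 'a measure) \<Rightarrow> 'a measure \<Rightarrow> bool" where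
  "aperiodic K X \<longleftrightarrow>
     \<not> (\<exists>d::nat. d \<ge> 2 \<and> (\<exists>D::nat \<Rightarrow> 'a set.
          (\<forall>i<d. D i \<in> sets X \<and> D i \<noteq> {}) \<and> disjoint_family_on D {..<d} \<and>
          (\<forall>i<d. \<forall>x\<in>D i. measure (K x) (D (Suc i mod d)) = 1)))"

definition invariant_prob :: "('a \<Rightarrow> 'a measure) \<Rightarrow> 'a measure \<Rightarrow> 'a measure \<Rightarrow> bool" where
  "invariant_prob K X \<mu> \<longleftrightarrow> prob_space \<mu> \<and> sets \<mu> = sets X \<and> bind \<mu> K = \<mu>"

text \<open>V-uniform ergodicity. V takes values in [1, infinity]; the bound is only informative
  (and only imposed) at points with V x finite.\<close>
definition V_uniformly_ergodic ::
  "('a \<Rightarrow> 'a measure) \<Rightarrow> 'a measure \<Rightarrow> 'a measure \<Rightarrow> ('a \<Rightarrow> ennreal) \<Rightarrow> bool" where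
  "V_uniformly_ergodic K X \<mu> V \<longleftrightarrow>
     K \<in> X \<rightarrow>\<^sub>M prob_algebra X \<and> psi_irreducible K X \<and> aperiodic K X \<and>
     invariant_prob K X \<mu> \<and>
     V \<in> borel_measurable X \<and> (\<forall>x\<in>space X. V x \<ge> 1) \<and> (\<integral>\<^sup>+ x. V x \<partial>\<mu>) < \<infinity> \<and>
     (\<exists>R::real. R > 0 \<and> (\<exists>\<rho>::real. \<rho> < 1 \<and>
        (\<forall>g \<in> borel_measurable X. (\<forall>x\<in>space X. ennreal \<bar>g x\<bar> \<le> V x) \<longrightarrow>
           (\<forall>x\<in>space X. \<forall>t::nat. V x < \<infinity> \<longrightarrow>
              \<bar>(\<integral>y. g y \<partial>(kpow K X t x)) - (\<integral>y. g y \<partial>\<mu>)\<bar> \<le> R * \<rho> ^ t * enn2real (V x)))))"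

text \<open>Splitting method on the probability space M. Particles are 0-indexed:
  xi t i, w t i, C t i for i < N t; Ns t i is the offspring number N_t^i;
  par t j is the index of the parent of the j-th child (j < N (Suc t)), so that
  hat-xi_t^j = xi t (par t j) and hat-w_t^j = w t (par t j) / C t (par t j).
  F t and Fh t are the filtrations F_t and hat-F_t. n0 is the (deterministic) N_0.\<close>
definition splitting_method ::
  "'w measure \<Rightarrow> 'a measure \<Rightarrow> ('a \<Rightarrow> 'a measure) \<Rightarrow> 'a measure \<Rightarrow> nat \<Rightarrow>
   (nat \<Rightarrow> 'w measure) \<Rightarrow> (nat \<Rightarrow> 'w measure) \<Rightarrow>
   (nat \<Rightarrow> 'w \<Rightarrow> nat) \<Rightarrow> (nat \<Rightarrow> nat \<Rightarrow> 'w \<Rightarrow> 'a) \<Rightarrow> (nat \<Rightarrow> nat \<Rightarrow> 'w \<Rightarrow> real) \<Rightarrow>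
   (nat \<Rightarrow> nat \<Rightarrow> 'w \<Rightarrow> real) \<Rightarrow> (nat \<Rightarrow> nat \<Rightarrow> 'w \<Rightarrow> nat) \<Rightarrow> (nat \<Rightarrow> nat \<Rightarrow> 'w \<Rightarrow> nat) \<Rightarrow> bool"
  where
  "splitting_method M X K \<mu>0 n0 F Fh N xi w C Ns par \<longleftrightarrow>
     prob_space M \<and> K \<in> X \<rightarrow>\<^sub>M prob_algebra X \<and> \<mu>0 \<in> space (prob_algebra X) \<and>
     \<comment> \<open>filtration\<close>
     (\<forall>t. subalgebra M (F t) \<and> subalgebra M (Fh t) \<and>
          sets (F t) \<subseteq> sets (Fh t) \<and> sets (Fh t) \<subseteq> sets (F (Suc t))) \<and>
     \<comment> \<open>(xi_t, w_t, C_t) and N_t are F_t-measurable\<close>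
     (\<forall>t. N t \<in> F t \<rightarrow>\<^sub>M count_space UNIV) \<and>
     (\<forall>t i. xi t i \<in> F t \<rightarrow>\<^sub>M X \<and> w t i \<in> borel_measurable (F t) \<and>
            C t i \<in> borel_measurable (F t)) \<and>
     \<comment> \<open>initialisation\<close>
     n0 > 0 \<and> (\<forall>\<omega>\<in>space M. N 0 \<omega> = n0) \<and>
     prob_space.indep_vars M (\<lambda>_. X) (\<lambda>i. xi 0 i) {..<n0} \<and>
     (\<forall>i<n0. distr M X (xi 0 i) = \<mu>0) \<and>
     (\<forall>i<n0. \<forall>\<omega>\<in>space M. w 0 i \<omega> = 1 / real n0) \<and>
     \<comment> \<open>splitting step\<close>
     (\<forall>t i. \<forall>\<omega>\<in>space M. i < N t \<omega> \<longrightarrow> C t i \<omega> > 0) \<and>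
     (\<forall>t i. Ns t i \<in> M \<rightarrow>\<^sub>M count_space UNIV) \<and>
     (\<forall>t i. AE \<omega> in M. i < N t \<omega> \<longrightarrow>
            nn_cond_exp M (F t) (\<lambda>\<omega>. ennreal (real (Ns t i \<omega>))) \<omega> = ennreal (C t i \<omega>)) \<and>
     (\<forall>t. \<forall>\<omega>\<in>space M. N (Suc t) \<omega> = (\<Sum>i<N t \<omega>. Ns t i \<omega>)) \<and>
     (\<forall>t. \<forall>\<omega>\<in>space M. (\<forall>j<N (Suc t) \<omega>. par t j \<omega> < N t \<omega>) \<and>
          (\<forall>i<N t \<omega>. card {j. j < N (Suc t) \<omega> \<and> par t j \<omega> = i} = Ns t i \<omega>)) \<and>
     \<comment> \<open>the children are hat-F_t-measurable\<close>
     (\<forall>t. N (Suc t) \<in> Fh t \<rightarrow>\<^sub>M count_space UNIV) \<and>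
     (\<forall>t j. par t j \<in> Fh t \<rightarrow>\<^sub>M count_space UNIV) \<and>
     \<comment> \<open>evolution step: weights\<close>
     (\<forall>t. \<forall>\<omega>\<in>space M. \<forall>j<N (Suc t) \<omega>.
          w (Suc t) j \<omega> = w t (par t j \<omega>) \<omega> / C t (par t j \<omega>) \<omega>) \<and>
     \<comment> \<open>evolution step: conditionally on hat-F_t, the new particles are independent
         with xi_(t+1)^j ~ K(hat-xi_t^j, .)\<close>
     (\<forall>t (J::nat set) (A::nat \<Rightarrow> 'a set). finite J \<longrightarrow> (\<forall>j\<in>J. A j \<in> sets X) \<longrightarrow>
        (AE \<omega> in M. J \<subseteq> {..<N (Suc t) \<omega>} \<longrightarrow>
           real_cond_exp M (Fh t) (\<lambda>\<omega>. \<Prod>j\<in>J. indicator (A j) (xi (Suc t) j \<omega>)) \<omega> =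
           (\<Prod>j\<in>J. measure (K (xi t (par t j \<omega>) \<omega>)) (A j))))"

end

(* The sums S_t(g) = sum_i w_t^i g(xi_t^i) satisfy E[Z S_{t+1}(g)] = E[Z S_t(K g)] for nonnegative
   g and nonnegative F_t-measurable Z.
   With g = 1 this makes the total weight a nonnegative martingale of mean 1. If its Cesaro averages
   tend to 1 in probability, they do so in L^1 (Scheffe), and conditioning on F_s forces the total
   weight at time s to be 1.
   Conversely, if the total weight is 1, then for 0 <= f with f^2 <= c V the geometric bound on
   K^n f - mu(f) makes the covariances of S_s(f) and S_t(f) decay geometrically in t - s, so the mean
   square of the averages up to T is O(1/T). Borel-Cantelli along T = k^2 and monotonicity of the
   partial sums in T give almost sure convergence. *)

theory Submission
  imports Defs "HOL-Library.Discrete_Functions" "HOL-Real_Asymp.Real_Asymp"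
begin

section \<open>Series and averages\<close>

text \<open>The ergodicity bound has an error of order V, while the strong law needs second moments.
  For f of order sqrt V, truncation improves the error to sqrt (r^n V): the exponential rate is
  halved, but a product of two sums then costs only a first moment of V. Indeed, once the total
  weight is 1, the weighted particles form a probability measure, and Jensen gives S_t(f)^2 <=
  S_t(f^2) <= c S_t(V).

  The other obstacle is the start: V is merely finite almost surely under \<open>\<mu>0\<close>, so
  S_0(V) may have infinite mean, and then second moments need not exist. All expectations in the
  strong law are therefore weighted by 1 / S_0(V). This weight is known at time 0, so it passes
  through every conditioning, and it is almost surely positive, so almost sure statements survive
  its removal.

  Covariances are bounded from above only, since negative ones do no harm. The one-step identity is
  kept in the extended nonnegative reals, where sums, integrals and iterates of K can be exchanged
  before anything is known to be finite.\<close>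

lemma suminf_lessThan_if:
  fixes g :: "nat \<Rightarrow> ennreal"
  shows "(\<Sum>i<n. g i) = (\<Sum>i. if i < n then g i else 0)"
  by (subst suminf_finite[of "{..<n}"]) auto

text \<open>Bounds, uniformly in \<open>T\<close>, the total covariance between time
  \<open>T\<close> and all earlier times.\<close>

lemma sum_geometric_le:
  fixes q :: real
  assumes "0 \<le> q" "q < 1"
  shows "(\<Sum>s<T. q ^ (T - s)) \<le> q / (1 - q)"
proof (induction T)
  case 0
  then show ?case using assms by simp
next
  case (Suc T)
  have "(\<Sum>s<Suc T. q ^ (Suc T - s)) = q * (\<Sum>s<T. q ^ (T - s)) + q"
    by (simp add: sum_distrib_left Suc_diff_le)
  also have "\<dots> \<le> q * (q / (1 - q)) + q"
    using Suc assms(1) by (intro add_mono mult_left_mono) auto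
  also have "\<dots> = q / (1 - q)"
    using assms(2) by (simp add: field_simps)
  finally show ?case .
qed

text \<open>Partial sums of nonnegative terms increase, so for T between k^2 and (k+1)^2 the average
  at T lies between the averages at these two squares, up to the factor k^2 / (k+1)^2 and its
  inverse, which tend to 1.\<close>

lemma averages_converge_if_along_squares:
  fixes s :: "nat \<Rightarrow> real"
  assumes nonneg: "\<And>t. 0 \<le> s t"
    and lim: "(\<lambda>k. (1 / real ((Suc k)\<^sup>2)) * (\<Sum>t<(Suc k)\<^sup>2. s t)) \<longlonglongrightarrow> m"
  shows "(\<lambda>T. (1 / real T) * (\<Sum>t<T. s t)) \<longlonglongrightarrow> m"
proof -
  define P where "P T = (\<Sum>t<T. s t)" for T :: nat
  define a where "a k = (1 / real (k\<^sup>2)) * P (k\<^sup>2)" for k :: nat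
  have P_mono: "P S \<le> P T" if "S \<le> T" for S T
    unfolding P_def using that nonneg by (intro sum_mono2) auto
  have P_nonneg: "0 \<le> P T" for T
    unfolding P_def by (intro sum_nonneg nonneg)
  have a: "a \<longlonglongrightarrow> m"
    using lim unfolding a_def P_def
    by (subst filterlim_sequentially_Suc[symmetric])
  have ratio: "(\<lambda>k. (real k)\<^sup>2 / (real (Suc k))\<^sup>2) \<longlonglongrightarrow> 1"
    by real_asymp
  have lower: "(\<lambda>k. a k * ((real k)\<^sup>2 / (real (Suc k))\<^sup>2)) \<longlonglongrightarrow> m"
    using tendsto_mult[OF a ratio] by simp
  have upper: "(\<lambda>k. a (Suc k) / ((real k)\<^sup>2 / (real (Suc k))\<^sup>2)) \<longlonglongrightarrow> m"
    using tendsto_divide[OF a[THEN LIMSEQ_Suc] ratio] by simp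
  \<comment> \<open>The square index belonging to T is k = \<open>floor_sqrt T\<close>, for which
    k^2 <= T < (k+1)^2.\<close>
  have k: "filterlim floor_sqrt at_top at_top"
    unfolding filterlim_at_top eventually_at_top_linorder
    by (auto intro!: exI[of _ "_\<^sup>2"] simp: le_floor_sqrt_iff)
  have "(\<lambda>T. (1 / real T) * P T) \<longlonglongrightarrow> m"
  proof (rule tendsto_sandwich[OF _ _ filterlim_compose[OF lower k] filterlim_compose[OF upper k]])
    show "\<forall>\<^sub>F T in sequentially. a (floor_sqrt T) * ((real (floor_sqrt T))\<^sup>2 / (real (Suc (floor_sqrt T)))\<^sup>2) \<le> 1 / real T * P T"
      using eventually_gt_at_top[of 0]
    proof eventually_elim
      case (elim T)
      let ?k = "floor_sqrt T"
      have "a ?k * ((real ?k)\<^sup>2 / (real (Suc ?k))\<^sup>2) = P (?k\<^sup>2) / (real (Suc ?k))\<^sup>2"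
        using elim by (simp add: a_def)
      also have "\<dots> \<le> P T / real T"
      proof (rule frac_le)
        have "T \<le> (Suc ?k)\<^sup>2" using Suc_floor_sqrt_power2_gt[of T] by simp
        then have "real T \<le> real ((Suc ?k)\<^sup>2)" by (rule of_nat_mono)
        then show "real T \<le> (real (Suc ?k))\<^sup>2" by simp
      qed (use elim P_mono P_nonneg in auto)
      finally show ?case by simp
    qed
    show "\<forall>\<^sub>F T in sequentially. 1 / real T * P T \<le> a (Suc (floor_sqrt T)) / ((real (floor_sqrt T))\<^sup>2 / (real (Suc (floor_sqrt T)))\<^sup>2)"
      using eventually_gt_at_top[of 0]
    proof eventually_elim
      case (elim T)
      let ?k = "floor_sqrt T"
      have "P T / real T \<le> P ((Suc ?k)\<^sup>2) / (real ?k)\<^sup>2"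
      proof (rule frac_le)
        have "?k\<^sup>2 \<le> T" by simp
        then have "real (?k\<^sup>2) \<le> real T" by (rule of_nat_mono)
        then show "(real ?k)\<^sup>2 \<le> real T" by simp
      qed (use elim P_mono P_nonneg Suc_floor_sqrt_power2_gt[of T] in \<open>auto intro: less_imp_le\<close>)
      also have "\<dots> = a (Suc ?k) / ((real ?k)\<^sup>2 / (real (Suc ?k))\<^sup>2)"
        unfolding a_def by simp
      finally show ?case by simp
    qed
  qed
  then show ?thesis unfolding P_def .
qed

section \<open>Iterated kernels\<close>

text \<open>With extended nonnegative values every iterate is defined, so moving the kernel from
  particles to test functions needs no integrability.\<close>

definition kop :: "('a \<Rightarrow> 'a measure) \<Rightarrow> ('a \<Rightarrow> ennreal) \<Rightarrow> 'a \<Rightarrow> ennreal" where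
  "kop K g x = (\<integral>\<^sup>+ y. g y \<partial>K x)"

lemma kernelD:
  assumes "K \<in> X \<rightarrow>\<^sub>M prob_algebra X" "x \<in> space X"
  shows "sets (K x) = sets X" "space (K x) = space X" "prob_space (K x)"
  using measurable_space[OF assms] sets_eq_imp_space_eq[of "K x" X]
  by (auto simp: space_prob_algebra)

lemma measurable_kop [measurable]:
  assumes "K \<in> X \<rightarrow>\<^sub>M prob_algebra X" "g \<in> borel_measurable X"
  shows "kop K g \<in> borel_measurable X"
  unfolding kop_def
  using measurable_compose[OF measurable_prob_algebraD[OF assms(1)]
      nn_integral_measurable_subprob_algebra[OF assms(2)]] .

lemma measurable_kop_funpow [measurable]:
  assumes "K \<in> X \<rightarrow>\<^sub>M prob_algebra X" "g \<in> borel_measurable X"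
  shows "(kop K ^^ n) g \<in> borel_measurable X"
  by (induction n) (simp_all add: assms measurable_kop)

lemma kpow_in_prob_algebra:
  assumes "K \<in> X \<rightarrow>\<^sub>M prob_algebra X" "x \<in> space X"
  shows "kpow K X n x \<in> space (prob_algebra X)"
proof (induction n)
  case 0
  then show ?case
    using measurable_space[OF measurable_return_prob_space assms(2)] by simp
next
  case (Suc n)
  then show ?case
    using prob_space_bind'[OF Suc assms(1)] sets_bind'[OF Suc assms(1)]
    by (simp add: space_prob_algebra)
qed

lemma kpowD:
  assumes "K \<in> X \<rightarrow>\<^sub>M prob_algebra X" "x \<in> space X"
  shows "sets (kpow K X n x) = sets X" "space (kpow K X n x) = space X"
    "prob_space (kpow K X n x)"
  using kpow_in_prob_algebra[OF assms, of n] sets_eq_imp_space_eq[of "kpow K X n x" X]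
  by (auto simp: space_prob_algebra)

text \<open>Connects the measures in the ergodicity bound with the operator powers that the
  recursion for S_t produces. The last transition is absorbed into the test function, which is why
  \<open>g\<close> varies in the induction.\<close>

lemma nn_integral_kpow:
  assumes K: "K \<in> X \<rightarrow>\<^sub>M prob_algebra X" and x: "x \<in> space X"
    and g: "g \<in> borel_measurable X"
  shows "(\<integral>\<^sup>+ y. g y \<partial>kpow K X n x) = (kop K ^^ n) g x"
  using g
proof (induction n arbitrary: g)
  case 0
  then show ?case using x by (simp add: nn_integral_return)
next
  case (Suc n)
  have "K \<in> kpow K X n x \<rightarrow>\<^sub>M subprob_algebra X"
    using measurable_prob_algebraD[OF K] measurable_cong_sets[OF kpowD(1)[OF K x, of n] refl] by blast
  then have "(\<integral>\<^sup>+ y. g y \<partial>kpow K X (Suc n) x) = (\<integral>\<^sup>+ y. kop K g y \<partial>kpow K X n x)"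
    using nn_integral_bind[OF Suc.prems] by (simp add: kop_def)
  also have "\<dots> = (kop K ^^ n) (kop K g) x"
    by (intro Suc.IH measurable_kop K Suc.prems)
  finally show ?case by (simp add: funpow_swap1)
qed

section \<open>Moments of V, and convergence for test functions of order sqrt V\<close>

locale geometric_ergodicity =
  fixes K :: "'a \<Rightarrow> 'a measure" and X \<mu> :: "'a measure" and V :: "'a \<Rightarrow> ennreal" and R r :: real
  assumes markov: "K \<in> X \<rightarrow>\<^sub>M prob_algebra X"
    and prob_\<mu>: "prob_space \<mu>" and sets_\<mu>: "sets \<mu> = sets X"
    and meas_V: "V \<in> borel_measurable X" and V_ge_1: "x \<in> space X \<Longrightarrow> 1 \<le> V x"
    and V_\<mu>: "(\<integral>\<^sup>+ x. V x \<partial>\<mu>) < \<infinity>"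
    and R_pos: "0 < R" and r_pos: "0 < r" and r_less_1: "r < 1"
    and bound: "g \<in> borel_measurable X \<Longrightarrow> (\<And>x. x \<in> space X \<Longrightarrow> ennreal \<bar>g x\<bar> \<le> V x) \<Longrightarrow>
      x \<in> space X \<Longrightarrow> V x < \<infinity> \<Longrightarrow>
      \<bar>(\<integral>y. g y \<partial>(kpow K X t x)) - (\<integral>y. g y \<partial>\<mu>)\<bar> \<le> R * r ^ t * enn2real (V x)"
begin

declare meas_V [measurable]

text \<open>This is the ergodicity bound for the test function V itself. Since V may be infinite and
  the bound concerns real functions, it is applied to the truncations of V at n, followed by
  monotone convergence.\<close>

lemma nn_integral_V_kpow:
  assumes x: "x \<in> space X" "V x < \<infinity>"
  shows "(\<integral>\<^sup>+ y. V y \<partial>kpow K X t x) \<le> (\<integral>\<^sup>+ y. V y \<partial>\<mu>) + ennreal (R * r ^ t) * V x"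
proof -
  let ?P = "kpow K X t x"
  interpret P: prob_space ?P by (rule kpowD(3)[OF markov x(1)])
  interpret \<mu>: prob_space \<mu> by (rule prob_\<mu>)
  have sets_P [measurable_cong]: "sets ?P = sets X" by (rule kpowD(1)[OF markov x(1)])
  note sets_\<mu>[measurable_cong]
  define g where "g n y = enn2real (min (V y) (of_nat n))" for n :: nat and y
  have [measurable]: "g n \<in> borel_measurable X" for n
    unfolding g_def by measurable
  have g: "ennreal (g n y) = min (V y) (of_nat n)" for n y
    unfolding g_def by (intro ennreal_enn2real) (auto simp: min_less_iff_disj of_nat_less_top)
  have g_nonneg: "0 \<le> g n y" for n y
    by (simp add: g_def)
  have g_le: "g n y \<le> real n" for n y
    unfolding g_def by (intro enn2real_leI) (auto simp: ennreal_of_nat_eq_real_of_nat)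
  have int: "integrable ?P (g n)" "integrable \<mu> (g n)" for n
    using g_nonneg g_le
    by (auto intro!: P.integrable_const_bound[of _ "real n"] \<mu>.integrable_const_bound[of _ "real n"])
  have *: "(\<integral>\<^sup>+ y. min (V y) (of_nat n) \<partial>?P) \<le> (\<integral>\<^sup>+ y. V y \<partial>\<mu>) + ennreal (R * r ^ t) * V x" for n
  proof -
    have "(\<integral>y. g n y \<partial>?P) \<le> (\<integral>y. g n y \<partial>\<mu>) + R * r ^ t * enn2real (V x)"
      using bound[of "g n" x t] x g_nonneg by (simp add: g)
    then have "ennreal (\<integral>y. g n y \<partial>?P) \<le> ennreal ((\<integral>y. g n y \<partial>\<mu>) + R * r ^ t * enn2real (V x))"
      by (rule ennreal_leI)
    also have "\<dots> = ennreal (\<integral>y. g n y \<partial>\<mu>) + ennreal (R * r ^ t * enn2real (V x))"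
      by (rule ennreal_plus) (use R_pos r_pos g_nonneg in auto)
    also have "ennreal (R * r ^ t * enn2real (V x)) = ennreal (R * r ^ t) * V x"
      using x R_pos r_pos by (simp add: ennreal_mult')
    also have "ennreal (\<integral>y. g n y \<partial>?P) = (\<integral>\<^sup>+ y. min (V y) (of_nat n) \<partial>?P)"
      by (subst nn_integral_eq_integral[symmetric, OF int(1)]) (auto simp: g g_nonneg)
    also have "ennreal (\<integral>y. g n y \<partial>\<mu>) = (\<integral>\<^sup>+ y. min (V y) (of_nat n) \<partial>\<mu>)"
      by (subst nn_integral_eq_integral[symmetric, OF int(2)]) (auto simp: g g_nonneg)
    also have "(\<integral>\<^sup>+ y. min (V y) (of_nat n) \<partial>\<mu>) \<le> (\<integral>\<^sup>+ y. V y \<partial>\<mu>)"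
      by (intro nn_integral_mono) simp
    finally show ?thesis by simp
  qed
  have "(SUP n. min v (of_nat n)) = v" for v :: ennreal
  proof (rule antisym)
    show "(SUP n. min v (of_nat n)) \<le> v"
      by (intro SUP_least) simp
    show "v \<le> (SUP n. min v (of_nat n))"
      using ennreal_SUP_of_nat_eq_top
      by (simp only: inf_min[symmetric] inf_SUP[symmetric] inf_top_right order_refl)
  qed
  then have "(\<integral>\<^sup>+ y. V y \<partial>?P) = (\<integral>\<^sup>+ y. (SUP n. min (V y) (of_nat n)) \<partial>?P)"
    by simp
  also have "\<dots> = (SUP n. \<integral>\<^sup>+ y. min (V y) (of_nat n) \<partial>?P)"
    by (rule nn_integral_monotone_convergence_SUP)
      (auto simp: incseq_def le_fun_def intro: min.coboundedI2)
  also have "\<dots> \<le> (\<integral>\<^sup>+ y. V y \<partial>\<mu>) + ennreal (R * r ^ t) * V x"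
    by (intro SUP_least *)
  finally show ?thesis .
qed

text \<open>From |f| <= 1 + f^2. It serves both for \<open>\<mu>\<close> and for the iterates of the
  kernel started at a point with finite V.\<close>

lemma integrable_sqrt_V:
  fixes f :: "'a \<Rightarrow> real"
  assumes P: "prob_space P" "sets P = sets X" "(\<integral>\<^sup>+ x. V x \<partial>P) < \<infinity>"
    and f [measurable]: "f \<in> borel_measurable X"
    and f_le: "\<And>x. x \<in> space X \<Longrightarrow> ennreal ((f x)\<^sup>2) \<le> ennreal c * V x"
  shows "integrable P f"
proof (rule integrableI_bounded)
  interpret prob_space P by fact
  note P(2)[measurable_cong]
  have sp: "space P = space X" using P(2) by (rule sets_eq_imp_space_eq)
  show "f \<in> borel_measurable P" by measurable
  have "(\<integral>\<^sup>+ x. ennreal (norm (f x)) \<partial>P) \<le> (\<integral>\<^sup>+ x. 1 + ennreal c * V x \<partial>P)"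
  proof (intro nn_integral_mono)
    fix x assume x: "x \<in> space P"
    have "\<bar>f x\<bar> \<le> 1 + (f x)\<^sup>2"
      using sum_squares_bound[of "\<bar>f x\<bar>" 1] by (auto simp: power2_eq_square)
    then have "ennreal (norm (f x)) \<le> 1 + ennreal ((f x)\<^sup>2)"
      using ennreal_leI[of "\<bar>f x\<bar>" "1 + (f x)\<^sup>2"] by simp
    also have "\<dots> \<le> 1 + ennreal c * V x"
      using f_le x sp by (intro add_left_mono) auto
    finally show "ennreal (norm (f x)) \<le> 1 + ennreal c * V x" .
  qed
  also have "\<dots> = 1 + ennreal c * (\<integral>\<^sup>+ x. V x \<partial>P)"
    by (simp add: nn_integral_add nn_integral_cmult emeasure_space_1)
  also have "\<dots> < \<infinity>"
    using P(3) by (simp add: ennreal_mult_less_top)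
  finally show "(\<integral>\<^sup>+ x. ennreal (norm (f x)) \<partial>P) < \<infinity>" .
qed

text \<open>Truncating at level \<open>sqrt (r ^ t * V x)\<close> balances the trivial bound on \<open>{f \<le> L}\<close>
  against the \<open>V\<close>-bound, applied to \<open>f \<le> f\<^sup>2 / L\<close>, on \<open>{f > L}\<close>.\<close>

lemma integral_kpow_sqrt_V:
  fixes f :: "'a \<Rightarrow> real"
  assumes f [measurable]: "f \<in> borel_measurable X" and f_nonneg: "\<And>x. x \<in> space X \<Longrightarrow> 0 \<le> f x"
    and c: "0 < c" and f_le: "\<And>x. x \<in> space X \<Longrightarrow> ennreal ((f x)\<^sup>2) \<le> ennreal c * V x"
    and x: "x \<in> space X" "V x < \<infinity>"
  shows "\<bar>(\<integral>y. f y \<partial>kpow K X t x) - (\<integral>y. f y \<partial>\<mu>)\<bar> \<le> (1 + c * R) * sqrt (r ^ t * enn2real (V x))"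
proof -
  let ?P = "kpow K X t x"
  interpret P: prob_space ?P by (rule kpowD(3)[OF markov x(1)])
  interpret \<mu>: prob_space \<mu> by (rule prob_\<mu>)
  have sets_P [measurable_cong]: "sets ?P = sets X" by (rule kpowD(1)[OF markov x(1)])
  note sets_\<mu>[measurable_cong]
  have sp: "space ?P = space X" "space \<mu> = space X"
    using sets_P sets_\<mu> by (auto dest: sets_eq_imp_space_eq)
  define v where "v = enn2real (V x)"
  have "1 \<le> v"
    using V_ge_1[OF x(1)] x(2) unfolding v_def by (cases "V x") auto
  define L where "L = sqrt (r ^ t * v)"
  have L: "0 < L" "L * L = r ^ t * v"
    using \<open>1 \<le> v\<close> r_pos unfolding L_def by auto
  define f1 f2 where "f1 y = (if f y \<le> L then f y else 0)" and "f2 y = (if f y \<le> L then 0 else f y)" for y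
  have [measurable]: "f1 \<in> borel_measurable X" "f2 \<in> borel_measurable X"
    unfolding f1_def f2_def by measurable
  have "(\<integral>\<^sup>+ y. V y \<partial>?P) < \<infinity>"
    using nn_integral_V_kpow[OF x, of t] V_\<mu> x(2)
    by (auto intro!: le_less_trans[OF nn_integral_V_kpow[OF x, of t]] simp: ennreal_mult_less_top)
  then have int: "integrable ?P f" "integrable \<mu> f"
    using integrable_sqrt_V[OF P.prob_space_axioms sets_P _ f f_le]
      integrable_sqrt_V[OF prob_\<mu> sets_\<mu> V_\<mu> f f_le] by auto
  have int1: "integrable ?P f1" "integrable \<mu> f1"
    by (rule Bochner_Integration.integrable_bound[OF int(1)], auto simp: f1_def)
       (rule Bochner_Integration.integrable_bound[OF int(2)], auto simp: f1_def)
  have int2: "integrable ?P f2" "integrable \<mu> f2"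
    by (rule Bochner_Integration.integrable_bound[OF int(1)], auto simp: f2_def)
       (rule Bochner_Integration.integrable_bound[OF int(2)], auto simp: f2_def)
  have split: "f = (\<lambda>y. f1 y + f2 y)"
    by (auto simp: f1_def f2_def)
  have "\<bar>(\<integral>y. f1 y \<partial>?P) - (\<integral>y. f1 y \<partial>\<mu>)\<bar> \<le> L"
  proof -
    have "f1 y \<in> {0..L}" if "y \<in> space X" for y
      using f_nonneg[OF that] L(1) by (auto simp: f1_def)
    then have "(\<integral>y. f1 y \<partial>?P) \<in> {0..L}" "(\<integral>y. f1 y \<partial>\<mu>) \<in> {0..L}"
      by (auto intro!: Bochner_Integration.integral_nonneg_AE P.integral_le_const \<mu>.integral_le_const int1 AE_I2
          simp: sp)
    then show ?thesis by auto
  qed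
  moreover have "\<bar>(\<integral>y. f2 y \<partial>?P) - (\<integral>y. f2 y \<partial>\<mu>)\<bar> \<le> c * R * L"
  proof -
    have "ennreal \<bar>L / c * f2 y\<bar> \<le> V y" if y: "y \<in> space X" for y
    proof (cases "V y")
      case (real u)
      have "L * f2 y \<le> (f y)\<^sup>2"
        using f_nonneg[OF y] by (auto simp: f2_def power2_eq_square mult_right_mono)
      also have "(f y)\<^sup>2 \<le> c * u"
        using f_le[OF y] real c by (simp add: ennreal_mult[symmetric])
      finally show ?thesis
        using real c L(1) f_nonneg[OF y] by (auto simp: f2_def field_simps)
    qed simp
    then have "\<bar>(\<integral>y. L / c * f2 y \<partial>?P) - (\<integral>y. L / c * f2 y \<partial>\<mu>)\<bar> \<le> R * r ^ t * v"
      unfolding v_def by (intro bound x) simp_all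
    \<comment> \<open>The level was chosen with \<open>L * L = r ^ t * v\<close>, so cancelling the
      factor \<open>L / c\<close> leaves an error of the same order L as on the other part.\<close>
    then have "L / c * \<bar>(\<integral>y. f2 y \<partial>?P) - (\<integral>y. f2 y \<partial>\<mu>)\<bar> \<le> R * (L * L)"
      using L(1) c unfolding L(2) by (simp add: right_diff_distrib[symmetric] abs_mult del: times_divide_eq_left)
    then show ?thesis
      using L(1) c by (simp add: field_simps)
  qed
  moreover have "(\<integral>y. f y \<partial>?P) = (\<integral>y. f1 y \<partial>?P) + (\<integral>y. f2 y \<partial>?P)"
    "(\<integral>y. f y \<partial>\<mu>) = (\<integral>y. f1 y \<partial>\<mu>) + (\<integral>y. f2 y \<partial>\<mu>)"
    by (subst split, simp add: int1 int2)+
  ultimately show ?thesis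
    unfolding v_def[symmetric] L_def[symmetric] by (simp add: distrib_right)
qed

end

section \<open>Splitting methods and the weight martingale\<close>

locale splitting =fixes M :: "'w measure" and X :: "'a measure" and K :: "'a \<Rightarrow> 'a measure"
    and \<mu>0 :: "'a measure" and n0 :: nat
    and F Fh :: "nat \<Rightarrow> 'w measure" and N :: "nat \<Rightarrow> 'w \<Rightarrow> nat"
    and xi :: "nat \<Rightarrow> nat \<Rightarrow> 'w \<Rightarrow> 'a" and w C :: "nat \<Rightarrow> nat \<Rightarrow> 'w \<Rightarrow> real"
    and Ns par :: "nat \<Rightarrow> nat \<Rightarrow> 'w \<Rightarrow> nat"
  assumes split: "splitting_method M X K \<mu>0 n0 F Fh N xi w C Ns par"
begin

lemma
  shows prob_space_M: "prob_space M"
    and kernel: "K \<in> X \<rightarrow>\<^sub>M prob_algebra X"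
    and init_measure: "\<mu>0 \<in> space (prob_algebra X)"
    and subalg_F: "subalgebra M (F t)" and subalg_Fh: "subalgebra M (Fh t)"
    and sets_F_Fh: "sets (F t) \<subseteq> sets (Fh t)" and sets_Fh_F: "sets (Fh t) \<subseteq> sets (F (Suc t))"
    and meas_N: "N t \<in> F t \<rightarrow>\<^sub>M count_space UNIV"
    and meas_xi: "xi t i \<in> F t \<rightarrow>\<^sub>M X"
    and meas_w: "w t i \<in> borel_measurable (F t)"
    and meas_C: "C t i \<in> borel_measurable (F t)"
    and n0_pos: "n0 > 0"
    and N_0: "\<omega> \<in> space M \<Longrightarrow> N 0 \<omega> = n0"
    and distr_xi_0: "i < n0 \<Longrightarrow> distr M X (xi 0 i) = \<mu>0"
    and w_0: "i < n0 \<Longrightarrow> \<omega> \<in> space M \<Longrightarrow> w 0 i \<omega> = 1 / real n0"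
    and C_pos: "\<omega> \<in> space M \<Longrightarrow> i < N t \<omega> \<Longrightarrow> C t i \<omega> > 0"
    and meas_Ns: "Ns t i \<in> M \<rightarrow>\<^sub>M count_space UNIV"
    and cond_exp_Ns: "AE \<omega> in M. i < N t \<omega> \<longrightarrow>
      nn_cond_exp M (F t) (\<lambda>\<omega>. ennreal (real (Ns t i \<omega>))) \<omega> = ennreal (C t i \<omega>)"
    and par_less: "\<omega> \<in> space M \<Longrightarrow> j < N (Suc t) \<omega> \<Longrightarrow> par t j \<omega> < N t \<omega>"
    and card_children: "\<omega> \<in> space M \<Longrightarrow> i < N t \<omega> \<Longrightarrow>
      card {j. j < N (Suc t) \<omega> \<and> par t j \<omega> = i} = Ns t i \<omega>"
    and meas_N_Suc: "N (Suc t) \<in> Fh t \<rightarrow>\<^sub>M count_space UNIV"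
    and meas_par: "par t j \<in> Fh t \<rightarrow>\<^sub>M count_space UNIV"
    and w_Suc: "\<omega> \<in> space M \<Longrightarrow> j < N (Suc t) \<omega> \<Longrightarrow>
      w (Suc t) j \<omega> = w t (par t j \<omega>) \<omega> / C t (par t j \<omega>) \<omega>"
    and evolution: "finite J \<Longrightarrow> (\<And>j. j \<in> J \<Longrightarrow> A j \<in> sets X) \<Longrightarrow>
      AE \<omega> in M. J \<subseteq> {..<N (Suc t) \<omega>} \<longrightarrow>
           real_cond_exp M (Fh t) (\<lambda>\<omega>. \<Prod>j\<in>J. indicator (A j) (xi (Suc t) j \<omega>)) \<omega> =
           (\<Prod>j\<in>J. measure (K (xi t (par t j \<omega>) \<omega>)) (A j))"
proof -
  note c0 = split[unfolded splitting_method_def]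
  note c1 = c0[THEN conjunct2]
  note c2 = c1[THEN conjunct2]
  note c3 = c2[THEN conjunct2]
  note c4 = c3[THEN conjunct2]
  note c5 = c4[THEN conjunct2]
  note c6 = c5[THEN conjunct2]
  note c7 = c6[THEN conjunct2]
  note c8 = c7[THEN conjunct2]
  note c9 = c8[THEN conjunct2]
  note c10 = c9[THEN conjunct2]
  note c11 = c10[THEN conjunct2]
  note c12 = c11[THEN conjunct2]
  note c13 = c12[THEN conjunct2]
  note c14 = c13[THEN conjunct2]
  note c15 = c14[THEN conjunct2]
  note c16 = c15[THEN conjunct2]
  note c17 = c16[THEN conjunct2]
  note c18 = c17[THEN conjunct2]
  note c19 = c18[THEN conjunct2]
  show "prob_space M"
    using c0[THEN conjunct1] by blast
  show "K \<in> X \<rightarrow>\<^sub>M prob_algebra X"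
    using c1[THEN conjunct1] by blast
  show "\<mu>0 \<in> space (prob_algebra X)"
    using c2[THEN conjunct1] by blast
  show "subalgebra M (F t)"
    using c3[THEN conjunct1] by blast
  show "subalgebra M (Fh t)"
    using c3[THEN conjunct1] by blast
  show "sets (F t) \<subseteq> sets (Fh t)"
    using c3[THEN conjunct1] by blast
  show "sets (Fh t) \<subseteq> sets (F (Suc t))"
    using c3[THEN conjunct1] by blast
  show "N t \<in> F t \<rightarrow>\<^sub>M count_space UNIV"
    using c4[THEN conjunct1] by blast
  show "xi t i \<in> F t \<rightarrow>\<^sub>M X"
    using c5[THEN conjunct1] by blast
  show "w t i \<in> borel_measurable (F t)"
    using c5[THEN conjunct1] by blast
  show "C t i \<in> borel_measurable (F t)"
    using c5[THEN conjunct1] by blast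
  show "n0 > 0"
    using c6[THEN conjunct1] by blast
  show "\<omega> \<in> space M \<Longrightarrow> N 0 \<omega> = n0"
    using c7[THEN conjunct1] by blast
  show "i < n0 \<Longrightarrow> distr M X (xi 0 i) = \<mu>0"
    using c9[THEN conjunct1] by blast
  show "i < n0 \<Longrightarrow> \<omega> \<in> space M \<Longrightarrow> w 0 i \<omega> = 1 / real n0"
    using c10[THEN conjunct1] by blast
  show "\<omega> \<in> space M \<Longrightarrow> i < N t \<omega> \<Longrightarrow> C t i \<omega> > 0"
    using c11[THEN conjunct1] by blast
  show "Ns t i \<in> M \<rightarrow>\<^sub>M count_space UNIV"
    using c12[THEN conjunct1] by blast
  show "AE \<omega> in M. i < N t \<omega> \<longrightarrow>
      nn_cond_exp M (F t) (\<lambda>\<omega>. ennreal (real (Ns t i \<omega>))) \<omega> = ennreal (C t i \<omega>)"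
    using c13[THEN conjunct1] by blast
  show "\<omega> \<in> space M \<Longrightarrow> j < N (Suc t) \<omega> \<Longrightarrow> par t j \<omega> < N t \<omega>"
    using c15[THEN conjunct1] by blast
  show "\<omega> \<in> space M \<Longrightarrow> i < N t \<omega> \<Longrightarrow>
      card {j. j < N (Suc t) \<omega> \<and> par t j \<omega> = i} = Ns t i \<omega>"
    using c15[THEN conjunct1] by blast
  show "N (Suc t) \<in> Fh t \<rightarrow>\<^sub>M count_space UNIV"
    using c16[THEN conjunct1] by blast
  show "par t j \<in> Fh t \<rightarrow>\<^sub>M count_space UNIV"
    using c17[THEN conjunct1] by blast
  show "\<omega> \<in> space M \<Longrightarrow> j < N (Suc t) \<omega> \<Longrightarrow>
      w (Suc t) j \<omega> = w t (par t j \<omega>) \<omega> / C t (par t j \<omega>) \<omega>"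
    using c18[THEN conjunct1] by blast
  show "finite J \<Longrightarrow> (\<And>j. j \<in> J \<Longrightarrow> A j \<in> sets X) \<Longrightarrow>
      AE \<omega> in M. J \<subseteq> {..<N (Suc t) \<omega>} \<longrightarrow>
           real_cond_exp M (Fh t) (\<lambda>\<omega>. \<Prod>j\<in>J. indicator (A j) (xi (Suc t) j \<omega>)) \<omega> =
           (\<Prod>j\<in>J. measure (K (xi t (par t j \<omega>) \<omega>)) (A j))"
    using c19 by blast
qed

section \<open>The filtration and measurability of the particle system\<close>

sublocale prob_space M
  by (rule prob_space_M)

lemma sigma_finite_F: "sigma_finite_subalgebra M (F t)"
proof -
  interpret finite_measure_subalgebra M "F t"
    by unfold_locales (rule subalg_F)
  show ?thesis ..
qed

lemma sigma_finite_Fh: "sigma_finite_subalgebra M (Fh t)"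
proof -
  interpret finite_measure_subalgebra M "Fh t"
    by unfold_locales (rule subalg_Fh)
  show ?thesis ..
qed

lemma subalg_F_Fh: "subalgebra (Fh t) (F t)"
  using subalg_F[of t] subalg_Fh[of t] sets_F_Fh[of t] by (auto simp: subalgebra_def)

lemma subalg_Fh_F: "subalgebra (F (Suc t)) (Fh t)"
  using subalg_F[of "Suc t"] subalg_Fh[of t] sets_Fh_F[of t] by (auto simp: subalgebra_def)

lemma subalg_F_mono: "s \<le> t \<Longrightarrow> subalgebra (F t) (F s)"
proof (induction t rule: dec_induct)
  case base
  then show ?case by (simp add: subalgebra_def)
next
  case (step t)
  then show ?case
    using subalg_F_Fh[of t] subalg_Fh_F[of t] by (auto simp: subalgebra_def)
qed

lemma space_F [simp]: "space (F t) = space M" and space_Fh [simp]: "space (Fh t) = space M"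
  using subalg_F[of t] subalg_Fh[of t] by (auto simp: subalgebra_def)

lemmas measurable_F_M = measurable_from_subalg[OF subalg_F]
lemmas measurable_Fh_M = measurable_from_subalg[OF subalg_Fh]
lemmas measurable_F_Fh = measurable_from_subalg[OF subalg_F_Fh]

declare meas_N [measurable] meas_xi [measurable] meas_w [measurable] meas_C [measurable]
  meas_Ns [measurable] meas_N_Suc [measurable] meas_par [measurable]

lemmas [measurable] =
  meas_N[THEN measurable_F_M] meas_xi[THEN measurable_F_M]
  meas_w[THEN measurable_F_M] meas_C[THEN measurable_F_M]
  meas_par[THEN measurable_Fh_M]
  meas_N[THEN measurable_F_Fh] meas_xi[THEN measurable_F_Fh]
  meas_w[THEN measurable_F_Fh] meas_C[THEN measurable_F_Fh]

lemma w_nonneg: "\<omega> \<in> space M \<Longrightarrow> i < N t \<omega> \<Longrightarrow> 0 \<le> w t i \<omega>"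
proof (induction t arbitrary: i)
  case 0
  then show ?case by (simp add: N_0 w_0)
next
  case (Suc t)
  then show ?case
    using par_less[of \<omega> i t] C_pos[of \<omega> "par t i \<omega>" t] by (simp add: w_Suc)
qed

section \<open>The one-step identity for weighted sums over particles\<close>

text \<open>This is S_t(g) for extended nonnegative g; converting the weights loses nothing because
  they are nonnegative.\<close>

definition wsum :: "nat \<Rightarrow> ('a \<Rightarrow> ennreal) \<Rightarrow> 'w \<Rightarrow> ennreal" where
  "wsum t g \<omega> = (\<Sum>i<N t \<omega>. ennreal (w t i \<omega>) * g (xi t i \<omega>))"

text \<open>The number of particles is random. Padding with zeros gives a fixed index set, over
  which integrals can be taken term by term.\<close>

lemma wsum_suminf:
  "wsum t g \<omega> = (\<Sum>i. if i < N t \<omega> then ennreal (w t i \<omega>) * g (xi t i \<omega>) else 0)"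
  unfolding wsum_def by (rule suminf_lessThan_if)

lemma measurable_wsum [measurable]:
  assumes [measurable]: "g \<in> borel_measurable X"
  shows "wsum t g \<in> borel_measurable (F t)"
  unfolding wsum_suminf[abs_def] by measurable

lemma measurable_wsum_M [measurable]:
  assumes [measurable]: "g \<in> borel_measurable X"
  shows "wsum t g \<in> borel_measurable M"
  by (rule measurable_F_M[OF measurable_wsum[OF assms]])

lemma measurable_parent [measurable]: "(\<lambda>\<omega>. xi t (par t j \<omega>) \<omega>) \<in> Fh t \<rightarrow>\<^sub>M X"
  by (rule measurable_compose_countable) measurable

text \<open>The case of a single child in the evolution step, moved to nonnegative conditional
  expectations. The conditional expectation of an indicator lies between 0 and 1 almost surely, so
  its real version determines the extended one.\<close>

lemma nn_cond_exp_evolution: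
  assumes A: "A \<in> sets X"
  shows "AE \<omega> in M. j < N (Suc t) \<omega> \<longrightarrow>
    nn_cond_exp M (Fh t) (\<lambda>\<omega>. indicator A (xi (Suc t) j \<omega>)) \<omega> = emeasure (K (xi t (par t j \<omega>) \<omega>)) A"
proof -
  interpret G: sigma_finite_subalgebra M "Fh t" by (rule sigma_finite_Fh)
  note A[measurable]
  let ?h = "\<lambda>\<omega>. indicator A (xi (Suc t) j \<omega>) :: ennreal"
  have "AE \<omega> in M. nn_cond_exp M (Fh t) ?h \<omega> \<le> nn_cond_exp M (Fh t) (\<lambda>_. 1) \<omega>"
    by (rule G.nn_cond_exp_mono) (auto simp: indicator_def)
  moreover have "AE \<omega> in M. 1 = nn_cond_exp M (Fh t) (\<lambda>_. 1) \<omega>"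
    by (rule G.nn_cond_exp_F_meas) auto
  moreover have "AE \<omega> in M. 0 = nn_cond_exp M (Fh t) (\<lambda>_. 0) \<omega>"
    by (rule G.nn_cond_exp_F_meas) auto
  moreover have "AE \<omega> in M. {j} \<subseteq> {..<N (Suc t) \<omega>} \<longrightarrow>
      real_cond_exp M (Fh t) (\<lambda>\<omega>. \<Prod>j\<in>{j}. indicator A (xi (Suc t) j \<omega>)) \<omega> =
      (\<Prod>j\<in>{j}. measure (K (xi t (par t j \<omega>) \<omega>)) A)"
    by (rule evolution) (use A in auto)
  moreover have "AE \<omega> in M. xi t (par t j \<omega>) \<omega> \<in> space X"
    using measurable_space[OF measurable_parent] by (intro AE_I2) auto
  ultimately show ?thesis
  proof eventually_elim
    case (elim \<omega>)
    interpret Kx: prob_space "K (xi t (par t j \<omega>) \<omega>)"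
      by (rule kernelD[OF kernel elim(5)])
    have h: "(\<lambda>\<omega>. ennreal (indicator A (xi (Suc t) j \<omega>))) = ?h"
      by (auto simp: indicator_def)
    have "nn_cond_exp M (Fh t) ?h \<omega> < top"
      using elim(1,2) by (auto intro: le_less_trans)
    then have "nn_cond_exp M (Fh t) ?h \<omega> = ennreal (enn2real (nn_cond_exp M (Fh t) ?h \<omega>))"
      by simp
    with elim(3,4) show ?case
      by (auto simp: real_cond_exp_def Kx.emeasure_eq_measure h ennreal_neg)
  qed
qed

text \<open>Weight the probability by \<open>Y\<close>. The image measure of the new particle then
  equals that of its parent followed by one transition of K: both agree on measurable sets by the
  evolution step, hence they integrate every \<open>g\<close> alike. The conditional law is known
  only where the j-th child exists, so \<open>Y\<close> has to vanish elsewhere.\<close>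

lemma nn_integral_evolution:
  assumes Y: "Y \<in> borel_measurable (Fh t)" and g: "g \<in> borel_measurable X"
    and Y_zero: "\<And>\<omega>. \<omega> \<in> space M \<Longrightarrow> \<not> j < N (Suc t) \<omega> \<Longrightarrow> Y \<omega> = 0"
  shows "(\<integral>\<^sup>+ \<omega>. Y \<omega> * g (xi (Suc t) j \<omega>) \<partial>M) = (\<integral>\<^sup>+ \<omega>. Y \<omega> * kop K g (xi t (par t j \<omega>) \<omega>) \<partial>M)"
proof -
  interpret G: sigma_finite_subalgebra M "Fh t" by (rule sigma_finite_Fh)
  note Y[measurable] measurable_Fh_M[OF Y, measurable] kernel[measurable]
    measurable_parent[THEN measurable_Fh_M, measurable]
  have sp: "\<omega> \<in> space M \<Longrightarrow> xi t (par t j \<omega>) \<omega> \<in> space X"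
    "\<omega> \<in> space M \<Longrightarrow> xi (Suc t) j \<omega> \<in> space X" for \<omega>
    using measurable_space[OF measurable_parent] measurable_space[OF meas_xi] by auto
  let ?D = "distr (density M Y) X (xi (Suc t) j)"
    and ?P = "distr (density M Y) X (\<lambda>\<omega>. xi t (par t j \<omega>) \<omega>)"
  have K_P: "K \<in> ?P \<rightarrow>\<^sub>M subprob_algebra X"
    using measurable_prob_algebraD[OF kernel] by simp
  have int_D: "(\<integral>\<^sup>+ x. f x \<partial>?D) = (\<integral>\<^sup>+ \<omega>. Y \<omega> * f (xi (Suc t) j \<omega>) \<partial>M)"
    and int_P: "(\<integral>\<^sup>+ x. f x \<partial>(?P \<bind> K)) = (\<integral>\<^sup>+ \<omega>. Y \<omega> * kop K f (xi t (par t j \<omega>) \<omega>) \<partial>M)"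
    if [measurable]: "f \<in> borel_measurable X" for f
  proof -
    show "(\<integral>\<^sup>+ x. f x \<partial>?D) = (\<integral>\<^sup>+ \<omega>. Y \<omega> * f (xi (Suc t) j \<omega>) \<partial>M)"
      by (simp add: nn_integral_distr nn_integral_density)
    have [measurable]: "kop K f \<in> borel_measurable X"
      by (rule measurable_kop[OF kernel that])
    have "(\<integral>\<^sup>+ x. f x \<partial>(?P \<bind> K)) = (\<integral>\<^sup>+ x. kop K f x \<partial>?P)"
      unfolding kop_def by (rule nn_integral_bind[OF that K_P])
    then show "(\<integral>\<^sup>+ x. f x \<partial>(?P \<bind> K)) = (\<integral>\<^sup>+ \<omega>. Y \<omega> * kop K f (xi t (par t j \<omega>) \<omega>) \<partial>M)"
      by (simp add: nn_integral_distr nn_integral_density)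
  qed
  have ne: "space X \<noteq> {}"
    using sp not_empty by blast
  have sets_eq: "sets (?P \<bind> K) = sets X"
    using ne kernelD(1)[OF kernel] by (intro sets_bind) auto
  have "?D = ?P \<bind> K"
  proof (rule measure_eqI)
    show "sets ?D = sets (?P \<bind> K)"
      by (simp add: sets_eq)
    fix A assume "A \<in> sets ?D"
    then have A[measurable]: "A \<in> sets X" by simp
    have "emeasure ?D A = (\<integral>\<^sup>+ x. indicator A x \<partial>?D)"
      by simp
    also have "\<dots> = (\<integral>\<^sup>+ \<omega>. Y \<omega> * indicator A (xi (Suc t) j \<omega>) \<partial>M)"
      by (rule int_D) simp
    also have "\<dots> = (\<integral>\<^sup>+ \<omega>. Y \<omega> * nn_cond_exp M (Fh t) (\<lambda>\<omega>. indicator A (xi (Suc t) j \<omega>)) \<omega> \<partial>M)"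
      by (rule G.nn_cond_exp_intg[symmetric]) auto
    also have "\<dots> = (\<integral>\<^sup>+ \<omega>. Y \<omega> * kop K (indicator A) (xi t (par t j \<omega>) \<omega>) \<partial>M)"
      using nn_cond_exp_evolution[OF A, of j t] AE_space
    proof (intro nn_integral_cong_AE, eventually_elim)
      fix \<omega>
      assume "j < N (Suc t) \<omega> \<longrightarrow> nn_cond_exp M (Fh t) (\<lambda>\<omega>. indicator A (xi (Suc t) j \<omega>)) \<omega>
          = emeasure (K (xi t (par t j \<omega>) \<omega>)) A" and "\<omega> \<in> space M"
      then show "Y \<omega> * nn_cond_exp M (Fh t) (\<lambda>\<omega>. indicator A (xi (Suc t) j \<omega>)) \<omega>
          = Y \<omega> * kop K (indicator A) (xi t (par t j \<omega>) \<omega>)"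
        using Y_zero[of \<omega>] by (cases "j < N (Suc t) \<omega>") (simp_all add: kop_def sp kernelD[OF kernel] A)
    qed
    also have "\<dots> = (\<integral>\<^sup>+ x. indicator A x \<partial>(?P \<bind> K))"
      by (rule int_P[symmetric]) simp
    also have "\<dots> = emeasure (?P \<bind> K) A"
      using A by (intro nn_integral_indicator) (simp add: sets_eq)
    finally show "emeasure ?D A = emeasure (?P \<bind> K) A" .
  qed
  with int_D[OF g] int_P[OF g] show ?thesis by simp
qed

lemma sum_over_parents:
  fixes \<phi> :: "nat \<Rightarrow> ennreal"
  assumes \<omega>: "\<omega> \<in> space M"
  shows "(\<Sum>j<N (Suc t) \<omega>. \<phi> (par t j \<omega>)) = (\<Sum>i<N t \<omega>. of_nat (Ns t i \<omega>) * \<phi> i)"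
proof -
  have "(\<Sum>j<N (Suc t) \<omega>. \<phi> (par t j \<omega>))
      = (\<Sum>i<N t \<omega>. \<Sum>j\<in>{j \<in> {..<N (Suc t) \<omega>}. par t j \<omega> = i}. \<phi> (par t j \<omega>))"
    by (rule sum.group[symmetric]) (use par_less[OF \<omega>] in auto)
  also have "\<dots> = (\<Sum>i<N t \<omega>. of_nat (Ns t i \<omega>) * \<phi> i)"
    by (rule sum.cong) (simp_all add: card_children[OF \<omega>])
  finally show ?thesis .
qed

text \<open>The two random stages are undone in reverse order. Conditioning on \<open>Fh t\<close>
  replaces g at a child by K g at its parent; collecting siblings produces the factor
  \<open>Ns t i\<close>; conditioning on \<open>F t\<close> turns this factor into
  \<open>C t i\<close>, which cancels the division of the parent's weight by
  \<open>C t i\<close>.\<close>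

lemma nn_integral_wsum_Suc:
  assumes Z: "Z \<in> borel_measurable (F t)" and g: "g \<in> borel_measurable X"
  shows "(\<integral>\<^sup>+ \<omega>. Z \<omega> * wsum (Suc t) g \<omega> \<partial>M) = (\<integral>\<^sup>+ \<omega>. Z \<omega> * wsum t (kop K g) \<omega> \<partial>M)"
proof -
  interpret FF: sigma_finite_subalgebra M "F t" by (rule sigma_finite_F)
  have kg [measurable]: "kop K g \<in> borel_measurable X"
    by (rule measurable_kop[OF kernel g])
  note g[measurable] Z[measurable]
  have [measurable]: "Z \<in> borel_measurable M" "Z \<in> borel_measurable (Fh t)"
    by (rule measurable_F_M[OF Z], rule measurable_F_Fh[OF Z])
  note measurable_parent[THEN measurable_Fh_M, measurable]
  define wh where "wh j \<omega> = w t (par t j \<omega>) \<omega> / C t (par t j \<omega>) \<omega>" for j \<omega>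
  have [measurable]: "wh j \<in> borel_measurable (Fh t)" for j
    unfolding wh_def
    by (rule measurable_compose_countable[where f="\<lambda>i \<omega>. w t i \<omega> / C t i \<omega>"]) measurable
  \<comment> \<open>\<open>wh j\<close> is the weight of the j-th child, already known in
    \<open>Fh t\<close>. The value 0 beyond the last child both pads the sum to a series and meets
    the vanishing condition of \<open>nn_integral_evolution\<close>.\<close>
  define Y where "Y j \<omega> = (if j < N (Suc t) \<omega> then Z \<omega> * ennreal (wh j \<omega>) else 0)" for j \<omega>
  have Y[measurable]: "Y j \<in> borel_measurable (Fh t)" for j
    unfolding Y_def by measurable
  note measurable_Fh_M[OF Y, measurable]
  define \<phi> where "\<phi> i \<omega> = ennreal (w t i \<omega> / C t i \<omega>) * kop K g (xi t i \<omega>)" for i \<omega>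
  define U where "U i \<omega> = (if i < N t \<omega> then Z \<omega> * \<phi> i \<omega> else 0)" for i \<omega>
  have U[measurable]: "U i \<in> borel_measurable (F t)" for i
    unfolding U_def \<phi>_def by measurable
  note measurable_F_M[OF U, measurable]
  have "(\<integral>\<^sup>+ \<omega>. Z \<omega> * wsum (Suc t) g \<omega> \<partial>M) = (\<integral>\<^sup>+ \<omega>. (\<Sum>j. Y j \<omega> * g (xi (Suc t) j \<omega>)) \<partial>M)"
    unfolding wsum_suminf ennreal_suminf_cmult[symmetric]
    by (intro nn_integral_cong suminf_cong) (auto simp: Y_def wh_def w_Suc mult.assoc)
  also have "\<dots> = (\<Sum>j. \<integral>\<^sup>+ \<omega>. Y j \<omega> * g (xi (Suc t) j \<omega>) \<partial>M)"
    by (rule nn_integral_suminf) measurable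
  also have "\<dots> = (\<Sum>j. \<integral>\<^sup>+ \<omega>. Y j \<omega> * kop K g (xi t (par t j \<omega>) \<omega>) \<partial>M)"
    by (intro suminf_cong nn_integral_evolution Y g) (simp add: Y_def)
  also have "\<dots> = (\<integral>\<^sup>+ \<omega>. (\<Sum>j. Y j \<omega> * kop K g (xi t (par t j \<omega>) \<omega>)) \<partial>M)"
    by (rule nn_integral_suminf[symmetric]) measurable
  \<comment> \<open>Siblings contribute equal terms, so the sum over children becomes a sum over
    parents. All factors other than \<open>Ns t i\<close> are then known at time t.\<close>
  also have "\<dots> = (\<integral>\<^sup>+ \<omega>. (\<Sum>i. U i \<omega> * ennreal (real (Ns t i \<omega>))) \<partial>M)"
  proof (intro nn_integral_cong)
    fix \<omega> assume \<omega>: "\<omega> \<in> space M"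
    have "(\<Sum>j. Y j \<omega> * kop K g (xi t (par t j \<omega>) \<omega>)) = (\<Sum>j<N (Suc t) \<omega>. Z \<omega> * \<phi> (par t j \<omega>) \<omega>)"
      unfolding suminf_lessThan_if
      by (intro suminf_cong) (simp add: Y_def \<phi>_def wh_def mult.assoc)
    also have "\<dots> = (\<Sum>i<N t \<omega>. of_nat (Ns t i \<omega>) * (Z \<omega> * \<phi> i \<omega>))"
      by (rule sum_over_parents[OF \<omega>])
    also have "\<dots> = (\<Sum>i. U i \<omega> * ennreal (real (Ns t i \<omega>)))"
      unfolding suminf_lessThan_if
      by (intro suminf_cong) (simp add: U_def mult.commute ennreal_of_nat_eq_real_of_nat)
    finally show "(\<Sum>j. Y j \<omega> * kop K g (xi t (par t j \<omega>) \<omega>)) = (\<Sum>i. U i \<omega> * ennreal (real (Ns t i \<omega>)))" .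
  qed
  also have "\<dots> = (\<Sum>i. \<integral>\<^sup>+ \<omega>. U i \<omega> * ennreal (real (Ns t i \<omega>)) \<partial>M)"
    by (rule nn_integral_suminf) measurable
  also have "\<dots> = (\<Sum>i. \<integral>\<^sup>+ \<omega>. U i \<omega> * nn_cond_exp M (F t) (\<lambda>\<omega>. ennreal (real (Ns t i \<omega>))) \<omega> \<partial>M)"
    by (intro suminf_cong FF.nn_cond_exp_intg[symmetric]) measurable
  also have "\<dots> = (\<Sum>i. \<integral>\<^sup>+ \<omega>. U i \<omega> * ennreal (C t i \<omega>) \<partial>M)"
  proof (intro suminf_cong nn_integral_cong_AE)
    fix i
    show "AE \<omega> in M. U i \<omega> * nn_cond_exp M (F t) (\<lambda>\<omega>. ennreal (real (Ns t i \<omega>))) \<omega>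
        = U i \<omega> * ennreal (C t i \<omega>)"
      using cond_exp_Ns[of i t] by eventually_elim (auto simp: U_def)
  qed
  also have "\<dots> = (\<integral>\<^sup>+ \<omega>. (\<Sum>i. U i \<omega> * ennreal (C t i \<omega>)) \<partial>M)"
    by (rule nn_integral_suminf[symmetric]) measurable
  also have "\<dots> = (\<integral>\<^sup>+ \<omega>. Z \<omega> * wsum t (kop K g) \<omega> \<partial>M)"
    unfolding wsum_suminf ennreal_suminf_cmult[symmetric]
  proof (intro nn_integral_cong suminf_cong)
    fix \<omega> i assume \<omega>: "\<omega> \<in> space M"
    have "ennreal (w t i \<omega> / C t i \<omega>) * ennreal (C t i \<omega>) = ennreal (w t i \<omega>)" if "i < N t \<omega>"
      using C_pos[OF \<omega> that] w_nonneg[OF \<omega> that] by (subst ennreal_mult[symmetric]) auto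
    then show "U i \<omega> * ennreal (C t i \<omega>)
        = Z \<omega> * (if i < N t \<omega> then ennreal (w t i \<omega>) * kop K g (xi t i \<omega>) else 0)"
      by (auto simp: U_def \<phi>_def mult.assoc mult.commute[of "kop K g (xi t i \<omega>)"])
         (metis mult.assoc)
  qed
  finally show ?thesis .
qed

text \<open>Each step moves one transition into the test function; \<open>Z\<close> stays admissible
  because it is known at all times after s.\<close>

lemma nn_integral_wsum_add:
  assumes Z: "Z \<in> borel_measurable (F s)" and g: "g \<in> borel_measurable X"
  shows "(\<integral>\<^sup>+ \<omega>. Z \<omega> * wsum (s + n) g \<omega> \<partial>M) = (\<integral>\<^sup>+ \<omega>. Z \<omega> * wsum s ((kop K ^^ n) g) \<omega> \<partial>M)"
  using g
proof (induction n arbitrary: g)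
  case 0
  then show ?case by simp
next
  case (Suc n)
  have "(\<integral>\<^sup>+ \<omega>. Z \<omega> * wsum (s + Suc n) g \<omega> \<partial>M) = (\<integral>\<^sup>+ \<omega>. Z \<omega> * wsum (s + n) (kop K g) \<omega> \<partial>M)"
    using nn_integral_wsum_Suc[of Z "s + n" g] measurable_from_subalg[OF subalg_F_mono Z, of "s + n"] Suc.prems
    by simp
  also have "\<dots> = (\<integral>\<^sup>+ \<omega>. Z \<omega> * wsum s ((kop K ^^ n) (kop K g)) \<omega> \<partial>M)"
    by (intro Suc.IH measurable_kop kernel Suc.prems)
  finally show ?case by (simp add: funpow_swap1)
qed

section \<open>The total weight as a martingale, and (i) implies (ii)\<close>

definition weight :: "nat \<Rightarrow> 'w \<Rightarrow> real" where
  "weight t \<omega> = (\<Sum>i<N t \<omega>. w t i \<omega>)"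

lemma weight_nonneg: "\<omega> \<in> space M \<Longrightarrow> 0 \<le> weight t \<omega>"
  unfolding weight_def by (intro sum_nonneg) (auto intro: w_nonneg)

lemma wsum_const:
  assumes \<omega>: "\<omega> \<in> space M"
  shows "wsum t (\<lambda>_. c) \<omega> = ennreal (weight t \<omega>) * c"
  unfolding wsum_def weight_def sum_distrib_right[symmetric]
  by (subst sum_ennreal) (auto intro: w_nonneg[OF \<omega>])

lemma measurable_weight [measurable]: "weight t \<in> borel_measurable (F t)"
proof -
  have "(\<lambda>\<omega>. enn2real (wsum t (\<lambda>_. 1) \<omega>)) \<in> borel_measurable (F t)"
    by measurable
  then show ?thesis
    by (rule measurable_cong[THEN iffD1, rotated])
      (simp add: wsum_const weight_nonneg)
qed

lemma measurable_weight_M [measurable]: "weight t \<in> borel_measurable M"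
  by (rule measurable_F_M[OF measurable_weight])

lemma wsum_cong: "\<omega> \<in> space M \<Longrightarrow> (\<And>x. x \<in> space X \<Longrightarrow> f x = g x) \<Longrightarrow> wsum t f \<omega> = wsum t g \<omega>"
  unfolding wsum_def using measurable_space[OF meas_xi] by (intro sum.cong) auto

lemma kop_funpow_one: "x \<in> space X \<Longrightarrow> (kop K ^^ n) (\<lambda>_. 1) x = 1"
  using nn_integral_kpow[OF kernel, of x "\<lambda>_. 1" n] kpowD(3)[OF kernel, of x n]
  by (simp add: prob_space.emeasure_space_1)

lemma nn_integral_weight:
  assumes Z: "Z \<in> borel_measurable (F s)" and "s \<le> t"
  shows "(\<integral>\<^sup>+ \<omega>. Z \<omega> * ennreal (weight t \<omega>) \<partial>M) = (\<integral>\<^sup>+ \<omega>. Z \<omega> * ennreal (weight s \<omega>) \<partial>M)"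
proof -
  have "(\<integral>\<^sup>+ \<omega>. Z \<omega> * ennreal (weight t \<omega>) \<partial>M) = (\<integral>\<^sup>+ \<omega>. Z \<omega> * wsum t (\<lambda>_. 1) \<omega> \<partial>M)"
    by (intro nn_integral_cong) (simp add: wsum_const)
  also have "\<dots> = (\<integral>\<^sup>+ \<omega>. Z \<omega> * wsum s ((kop K ^^ (t - s)) (\<lambda>_. 1)) \<omega> \<partial>M)"
    using nn_integral_wsum_add[OF Z, of "\<lambda>_. 1" "t - s"] assms(2) by simp
  also have "\<dots> = (\<integral>\<^sup>+ \<omega>. Z \<omega> * wsum s (\<lambda>_. 1) \<omega> \<partial>M)"
    by (intro nn_integral_cong arg_cong2[where f="(*)"] refl wsum_cong kop_funpow_one)
  also have "\<dots> = (\<integral>\<^sup>+ \<omega>. Z \<omega> * ennreal (weight s \<omega>) \<partial>M)"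
    by (intro nn_integral_cong) (simp add: wsum_const)
  finally show ?thesis .
qed

lemma weight_0: "\<omega> \<in> space M \<Longrightarrow> weight 0 \<omega> = 1"
  using n0_pos by (simp add: weight_def N_0 w_0)

text \<open>The martingale property in integrated form: \<open>Z\<close> is taken to be the
  indicator of an event known at time s. As the mean is 1 at every time, the extended identity
  passes to real integrals without loss.\<close>

lemma
  assumes A: "A \<in> sets (F s)" and "s \<le> t"
  shows integrable_weight: "integrable M (weight t)"
    and set_integral_weight: "(LINT \<omega>:A|M. weight t \<omega>) = (LINT \<omega>:A|M. weight s \<omega>)"
proof -
  have A_M [measurable]: "A \<in> sets M"
    using A subalg_F[of s] by (auto simp: subalgebra_def)
  have nn_1: "(\<integral>\<^sup>+ \<omega>. ennreal (weight u \<omega>) \<partial>M) = 1" for u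
  proof -
    have "(\<integral>\<^sup>+ \<omega>. ennreal (weight u \<omega>) \<partial>M) = (\<integral>\<^sup>+ \<omega>. ennreal (weight 0 \<omega>) \<partial>M)"
      using nn_integral_weight[of "\<lambda>_. 1" 0 u] by simp
    also have "\<dots> = (\<integral>\<^sup>+ \<omega>. 1 \<partial>M)"
      by (intro nn_integral_cong) (simp add: weight_0)
    finally show ?thesis by (simp add: emeasure_space_1)
  qed
  have int: "integrable M (weight u)" for u
    by (rule integrableI_nonneg) (simp_all add: nn_1 weight_nonneg)
  then show "integrable M (weight t)" .
  have set_int: "set_integrable M A (weight u)" for u
    unfolding set_integrable_def by (intro integrable_mult_indicator A_M int)
  have nn_eq: "ennreal (LINT \<omega>:A|M. weight u \<omega>) = (\<integral>\<^sup>+ \<omega>. indicator A \<omega> * ennreal (weight u \<omega>) \<partial>M)" for u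
    unfolding set_lebesgue_integral_def
    by (subst nn_integral_eq_integral[symmetric])
      (use set_int[of u] in \<open>auto simp: set_integrable_def weight_nonneg indicator_def intro!: nn_integral_cong\<close>)
  have nonneg: "0 \<le> (LINT \<omega>:A|M. weight u \<omega>)" for u
    unfolding set_lebesgue_integral_def
    by (intro Bochner_Integration.integral_nonneg_AE AE_I2) (auto simp: weight_nonneg)
  have "ennreal (LINT \<omega>:A|M. weight t \<omega>) = ennreal (LINT \<omega>:A|M. weight s \<omega>)"
    unfolding nn_eq using A by (intro nn_integral_weight assms(2)) auto
  then show "(LINT \<omega>:A|M. weight t \<omega>) = (LINT \<omega>:A|M. weight s \<omega>)"
    using nonneg by simp
qed

lemma expectation_weight: "expectation (weight t) = 1"
proof -
  have "expectation (weight t) = expectation (weight 0)"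
    using set_integral_weight[of "space M" 0 t] sets.top[of "F 0"]
    by (simp add: set_integral_space[OF integrable_weight[of "space M" 0]])
  also have "\<dots> = expectation (\<lambda>_. 1)"
    by (intro Bochner_Integration.integral_cong) (simp_all add: weight_0)
  finally show ?thesis by (simp add: prob_space)
qed

text \<open>As the averages are nonnegative with mean 1, convergence in probability improves to
  convergence in \<open>L\<^sup>1\<close>. By the martingale property, \<open>weight s\<close> is nearly the conditional
  expectation of the average over times up to \<open>T\<close>, for every fixed \<open>s\<close>.\<close>

lemma weight_eq_1_if_average_converges:
  assumes conv: "\<And>\<epsilon>. \<epsilon> > 0 \<Longrightarrow> (\<lambda>T::nat. measure M {\<omega>\<in>space M.
              \<bar>(1 / real T) * (\<Sum>t<T. weight t \<omega>) - 1\<bar> > \<epsilon>}) \<longlonglongrightarrow> 0"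
  shows "AE \<omega> in M. weight s \<omega> = 1"
proof -
  interpret G: sigma_finite_subalgebra M "F s" by (rule sigma_finite_F)
  note int = integrable_weight[OF sets.top order.refl]
  define B where "B \<epsilon> T = {\<omega>\<in>space M. \<bar>(1 / real T) * (\<Sum>t<T. weight t \<omega>) - 1\<bar> > \<epsilon>}" for \<epsilon> and T :: nat
  define a where "a T \<omega> = (1 / real T) * (\<Sum>t<T. weight t \<omega>)" for T :: nat and \<omega>
  have int_a: "integrable M (a T)" for T
    unfolding a_def by (intro Bochner_Integration.integrable_mult_right Bochner_Integration.integrable_sum int)
  have [measurable]: "B \<epsilon> T \<in> sets M" for \<epsilon> T
    unfolding B_def by measurable
  \<comment> \<open>Scheffe's argument in quantitative form: |x - 1| = (x - 1) + 2 max 0 (1 - x).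
    The first summand has mean 0, and for x >= 0 the positive part of 1 - x is at most \<epsilon>
    off the bad event \<open>B\<close> and at most 1 on it.\<close>
  have L1: "expectation (\<lambda>\<omega>. \<bar>a T \<omega> - 1\<bar>) \<le> 2 * \<epsilon> + 2 * measure M (B \<epsilon> T)" if "\<epsilon> > 0" "T > 0" for \<epsilon> and T :: nat
  proof -
    have "expectation (\<lambda>\<omega>. \<bar>a T \<omega> - 1\<bar>) \<le> expectation (\<lambda>\<omega>. a T \<omega> - 1 + 2 * (\<epsilon> + indicator (B \<epsilon> T) \<omega>))"
    proof (rule integral_mono)
      fix \<omega> assume \<omega>: "\<omega> \<in> space M"
      have "0 \<le> a T \<omega>"
        unfolding a_def by (intro mult_nonneg_nonneg sum_nonneg) (auto simp: weight_nonneg \<omega>)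
      moreover have "\<bar>a T \<omega> - 1\<bar> > \<epsilon> \<longleftrightarrow> \<omega> \<in> B \<epsilon> T"
        using \<omega> by (simp add: a_def B_def)
      ultimately show "\<bar>a T \<omega> - 1\<bar> \<le> a T \<omega> - 1 + 2 * (\<epsilon> + indicator (B \<epsilon> T) \<omega>)"
        using \<open>\<epsilon> > 0\<close> by (auto simp: indicator_def)
    qed (auto intro!: int_a Bochner_Integration.integrable_add Bochner_Integration.integrable_diff
          integrable_real_indicator simp: emeasure_eq_measure)
    also have "\<dots> = expectation (a T) - 1 + 2 * (\<epsilon> + measure M (B \<epsilon> T))"
      by (simp add: int_a emeasure_eq_measure prob_space)
    also have "expectation (a T) = 1"
      using \<open>T > 0\<close> unfolding a_def by (simp add: int expectation_weight)
    finally show ?thesis by simp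
  qed
  have eq: "(LINT \<omega>:A|M. weight s \<omega>) = measure M A" if A: "A \<in> sets (F s)" for A
  proof -
    have A_M [measurable]: "A \<in> sets M"
      using A subalg_F[of s] by (auto simp: subalgebra_def)
    define d where "d = \<bar>(LINT \<omega>:A|M. weight s \<omega>) - measure M A\<bar>"
    \<comment> \<open>Replacing the averages by 1 costs the \<open>L1\<close> bound. Replacing them
      by \<open>weight s\<close> costs at most s / T: from time s on, the integrals over A equal
      \<open>W s\<close>, and each of the s earlier ones differs from it by at most 1, since all lie
      between 0 and the mean 1.\<close>
    have le: "d \<le> 2 * \<epsilon> + 2 * measure M (B \<epsilon> T) + real s / real T" if "\<epsilon> > 0" "T > s" for \<epsilon> and T :: nat
    proof -
      have T: "T > 0" using that by simp
      define W where "W t = (LINT \<omega>:A|M. weight t \<omega>)" for t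
      have set_int: "integrable M (\<lambda>\<omega>. indicator A \<omega> * weight t \<omega>)" for t
        using integrable_mult_indicator[OF A_M int] by simp
      have "(LINT \<omega>:A|M. a T \<omega>) = expectation (\<lambda>\<omega>. (1 / real T) * (\<Sum>t<T. indicator A \<omega> * weight t \<omega>))"
        unfolding set_lebesgue_integral_def a_def
        by (intro Bochner_Integration.integral_cong) (auto simp: indicator_def)
      also have "\<dots> = (1 / real T) * (\<Sum>t<T. W t)"
        unfolding W_def set_lebesgue_integral_def
        by (subst integral_mult_right_zero, subst Bochner_Integration.integral_sum) (auto intro: set_int)
      finally have LINT_a: "(LINT \<omega>:A|M. a T \<omega>) = (1 / real T) * (\<Sum>t<T. W t)" .
      have W: "W t \<in> {0..1}" for t
      proof -
        have "0 \<le> W t"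
          unfolding set_lebesgue_integral_def W_def
          by (intro Bochner_Integration.integral_nonneg_AE AE_I2) (auto simp: weight_nonneg)
        moreover have "W t \<le> expectation (weight t)"
          unfolding set_lebesgue_integral_def W_def
          by (intro integral_mono int integrable_mult_indicator A_M) (auto simp: weight_nonneg indicator_def)
        ultimately show ?thesis by (simp add: expectation_weight)
      qed
      have "(\<Sum>t<T. W t) - real T * W s = (\<Sum>t<T. W t - W s)"
        by (simp add: sum_subtractf)
      also have "\<dots> = (\<Sum>t<s. W t - W s)"
      proof (intro sum.mono_neutral_right ballI)
        fix t assume "t \<in> {..<T} - {..<s}"
        then have "W t = W s"
          unfolding W_def by (intro set_integral_weight[OF A]) simp
        then show "W t - W s = 0" by simp
      qed (use that in auto)
      also have "\<bar>\<dots>\<bar> \<le> (\<Sum>t<s. 1)"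
      proof (rule order_trans[OF sum_abs], rule sum_mono)
        fix t show "\<bar>W t - W s\<bar> \<le> 1"
          using W[of t] W[of s] by auto
      qed
      finally have "\<bar>(\<Sum>t<T. W t) - real T * W s\<bar> / real T \<le> real s / real T"
        using T by (intro divide_right_mono) auto
      also have "\<bar>(\<Sum>t<T. W t) - real T * W s\<bar> / real T = \<bar>((\<Sum>t<T. W t) - real T * W s) / real T\<bar>"
        by simp
      also have "((\<Sum>t<T. W t) - real T * W s) / real T = (LINT \<omega>:A|M. a T \<omega>) - W s"
        using T by (simp add: LINT_a diff_divide_distrib)
      finally have 1: "\<bar>(LINT \<omega>:A|M. a T \<omega>) - (LINT \<omega>:A|M. weight s \<omega>)\<bar> \<le> real s / real T"
        by (simp only: W_def)
      have "\<bar>(LINT \<omega>:A|M. a T \<omega>) - measure M A\<bar> = \<bar>expectation (\<lambda>\<omega>. indicator A \<omega> * (a T \<omega> - 1))\<bar>"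
        unfolding set_lebesgue_integral_def
        by (simp add: right_diff_distrib integrable_mult_indicator[OF A_M int_a, unfolded real_scaleR_def]
             emeasure_eq_measure)
      also have "\<dots> \<le> expectation (\<lambda>\<omega>. \<bar>indicator A \<omega> * (a T \<omega> - 1)\<bar>)"
        by (rule integral_abs_bound)
      also have "\<dots> \<le> expectation (\<lambda>\<omega>. \<bar>a T \<omega> - 1\<bar>)"
        using integrable_mult_indicator[OF A_M, of "\<lambda>\<omega>. a T \<omega> - 1"] int_a
        by (intro integral_mono integrable_abs) (auto split: split_indicator)
      also have "\<dots> \<le> 2 * \<epsilon> + 2 * measure M (B \<epsilon> T)"
        by (rule L1[OF that(1) T])
      finally show ?thesis using 1 unfolding d_def by linarith
    qed
    have "d \<le> 0 + e" if "e > 0" for e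
    proof -
      have "(\<lambda>T. 2 * (e/2) + 2 * measure M (B (e/2) T) + real s / real T) \<longlonglongrightarrow> 2 * (e/2) + 2 * 0 + 0"
        unfolding B_def using that by (intro tendsto_intros conv lim_const_over_n) auto
      moreover have "\<exists>N. \<forall>T\<ge>N. d \<le> 2 * (e/2) + 2 * measure M (B (e/2) T) + real s / real T"
        using le[of "e/2"] that by (intro exI[of _ "Suc s"]) auto
      ultimately show ?thesis
        using LIMSEQ_le_const by fastforce
    qed
    then have "d \<le> 0" by (rule field_le_epsilon)
    then show ?thesis by (simp add: d_def)
  qed
  \<comment> \<open>By \<open>eq\<close>, \<open>weight s\<close> and the constant 1 have the same
    integral over every event of \<open>F s\<close>. As \<open>weight s\<close> is measurable there,
    it is a version of the conditional expectation of 1.\<close>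
  have "AE \<omega> in M. real_cond_exp M (F s) (\<lambda>_. 1) \<omega> = weight s \<omega>"
  proof (rule G.real_cond_exp_charact)
    fix A assume A: "A \<in> sets (F s)"
    then have "A \<in> sets M"
      using subalg_F[of s] by (auto simp: subalgebra_def)
    then show "(LINT \<omega>:A|M. 1) = (LINT \<omega>:A|M. weight s \<omega>)"
      using eq[OF A] by (simp add: set_lebesgue_integral_def)
  qed (auto intro: int)
  moreover have "AE \<omega> in M. real_cond_exp M (F s) (\<lambda>_. 1) \<omega> = 1"
    by (rule G.real_cond_exp_F_meas) auto
  ultimately show ?thesis by eventually_elim simp
qed

end

section \<open>The strong law under geometric ergodicity\<close>

text \<open>The assumption \<open>weight_1\<close> is condition (ii). It makes S_t integration
  against a probability measure, almost surely.\<close>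

locale ergodic_splitting =
  splitting M X K \<mu>0 n0 F Fh N xi w C Ns par + geometric_ergodicity K X \<mu> V R r
  for M :: "'w measure" and X :: "'a measure" and K :: "'a \<Rightarrow> 'a measure"
    and \<mu>0 :: "'a measure" and n0 :: nat
    and F Fh :: "nat \<Rightarrow> 'w measure" and N :: "nat \<Rightarrow> 'w \<Rightarrow> nat"
    and xi :: "nat \<Rightarrow> nat \<Rightarrow> 'w \<Rightarrow> 'a" and w C :: "nat \<Rightarrow> nat \<Rightarrow> 'w \<Rightarrow> real"
    and Ns par :: "nat \<Rightarrow> nat \<Rightarrow> 'w \<Rightarrow> nat"
    and \<mu> :: "'a measure" and V :: "'a \<Rightarrow> ennreal" and R r :: real +
  assumes V_fin: "emeasure \<mu>0 {x\<in>space X. V x < \<infinity>} = 1"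
    and weight_1: "AE \<omega> in M. \<forall>t. weight t \<omega> = 1"
begin

text \<open>Ergodicity says nothing at points where V is infinite. If S_t(V) is finite, particles at
  such points have weight 0, so a comparison on the set of finite V is enough.\<close>

lemma wsum_mono_V:
  assumes \<omega>: "\<omega> \<in> space M" and fin: "wsum t V \<omega> < \<infinity>"
    and le: "\<And>x. x \<in> space X \<Longrightarrow> V x < \<infinity> \<Longrightarrow> f x \<le> g x"
  shows "wsum t f \<omega> \<le> wsum t g \<omega>"
  unfolding wsum_def
proof (rule sum_mono)
  fix i assume i: "i \<in> {..<N t \<omega>}"
  have x: "xi t i \<omega> \<in> space X"
    using measurable_space[OF meas_xi] \<omega> by auto
  have "ennreal (w t i \<omega>) * V (xi t i \<omega>) \<le> wsum t V \<omega>"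
    unfolding wsum_def by (rule member_le_sum) (use i in auto)
  with fin have "ennreal (w t i \<omega>) = 0 \<or> V (xi t i \<omega>) < \<infinity>"
    by (cases "V (xi t i \<omega>)") (auto simp: ennreal_mult_top top_unique split: if_splits)
  then show "ennreal (w t i \<omega>) * f (xi t i \<omega>) \<le> ennreal (w t i \<omega>) * g (xi t i \<omega>)"
    using le[OF x] by (auto intro: mult_left_mono)
qed

lemma wsum_add: "wsum t (\<lambda>x. f x + g x) \<omega> = wsum t f \<omega> + wsum t g \<omega>"
  by (simp add: wsum_def distrib_left sum.distrib)

lemma wsum_cmult: "wsum t (\<lambda>x. c * f x) \<omega> = c * wsum t f \<omega>"
  by (simp add: wsum_def sum_distrib_left mult_ac)

lemma wsum_V_ge_1:
  assumes \<omega>: "\<omega> \<in> space M" and "weight t \<omega> = 1"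
  shows "1 \<le> wsum t V \<omega>"
proof -
  have "1 = wsum t (\<lambda>_. 1) \<omega>"
    by (simp add: wsum_const \<omega> assms)
  also have "\<dots> \<le> wsum t V \<omega>"
    unfolding wsum_def using measurable_space[OF meas_xi] \<omega>
    by (intro sum_mono mult_left_mono V_ge_1) auto
  finally show ?thesis .
qed

section \<open>Moments of V under the density 1 / S_0(V)\<close>

lemma AE_wsum_0_V_finite: "AE \<omega> in M. wsum 0 V \<omega> < \<infinity>"
proof -
  have ae: "AE \<omega> in M. V (xi 0 i \<omega>) < \<infinity>" if "i < n0" for i
  proof -
    interpret I: prob_space \<mu>0
      using init_measure by (simp add: space_prob_algebra)
    have "sets \<mu>0 = sets X"
      using init_measure by (simp add: space_prob_algebra)
    then have "AE x in \<mu>0. x \<in> {x\<in>space X. V x < \<infinity>}"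
      using V_fin by (intro I.AE_prob_1) (auto simp: measure_def)
    then have "AE x in distr M X (xi 0 i). V x < \<infinity>"
      unfolding distr_xi_0[OF that] by auto
    then show ?thesis
      by (subst (asm) AE_distr_iff) auto
  qed
  have "AE \<omega> in M. \<forall>i\<in>{..<n0}. V (xi 0 i \<omega>) < \<infinity>"
    by (rule AE_finite_allI) (use ae in auto)
  with AE_space show ?thesis
    by eventually_elim (auto simp: wsum_def N_0 ennreal_mult_less_top)
qed

text \<open>Since only \<open>\<mu>0 {V < \<infinity>} = 1\<close> is known, expectations are taken with this density, which is
  positive almost surely and compensates the possibly infinite initial mean of \<open>V\<close>.\<close>

definition dens :: "'w \<Rightarrow> real" where
  "dens \<omega> = enn2real (inverse (wsum 0 V \<omega>))"

lemma ennreal_dens: "\<omega> \<in> space M \<Longrightarrow> ennreal (dens \<omega>) = inverse (wsum 0 V \<omega>)"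
  using wsum_V_ge_1[of \<omega> 0] weight_0[of \<omega>] unfolding dens_def
  by (cases "wsum 0 V \<omega>") (auto simp: inverse_ennreal)

lemma measurable_dens [measurable]: "dens \<in> borel_measurable (F 0)" "dens \<in> borel_measurable M"
proof -
  show "dens \<in> borel_measurable (F 0)"
    unfolding dens_def by measurable
  then show "dens \<in> borel_measurable M" by (rule measurable_F_M)
qed

lemma dens_bounds: "0 \<le> dens \<omega>" and dens_le_1: "\<omega> \<in> space M \<Longrightarrow> dens \<omega> \<le> 1"
proof -
  show "0 \<le> dens \<omega>" by (simp add: dens_def)
  show "dens \<omega> \<le> 1" if "\<omega> \<in> space M"
    using wsum_V_ge_1[OF that weight_0[OF that]] unfolding dens_def
    by (cases "wsum 0 V \<omega>") (auto simp: inverse_ennreal inverse_le_1_iff)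
qed

lemma dens_pos: "wsum 0 V \<omega> < \<infinity> \<Longrightarrow> \<omega> \<in> space M \<Longrightarrow> 0 < dens \<omega>"
  using ennreal_dens[of \<omega>] by (cases "dens \<omega> = 0") (auto simp: less_le dens_bounds)

text \<open>Only an inequality, because the product is 0 where S_0(V) is infinite. It is the
  normalisation that replaces a finite initial moment of V.\<close>

lemma dens_wsum_0_V: "\<omega> \<in> space M \<Longrightarrow> ennreal (dens \<omega>) * wsum 0 V \<omega> \<le> 1"
  unfolding ennreal_dens using wsum_V_ge_1[of \<omega> 0] weight_0[of \<omega>]
  by (cases "wsum 0 V \<omega>") (auto simp: inverse_ennreal ennreal_mult[symmetric])

text \<open>By \<open>nn_integral_V_kpow\<close>, V >= 1 and r^t <= 1, this constant satisfies K^t V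
  <= \<kappa> V for all t wherever V is finite.\<close>

definition \<kappa> :: ennreal where
  "\<kappa> = (\<integral>\<^sup>+ x. V x \<partial>\<mu>) + ennreal R"

lemma \<kappa>_finite: "\<kappa> < \<infinity>"
  using V_\<mu> by (simp add: \<kappa>_def)

text \<open>The density is known at time 0, so all t transitions can be moved onto V. There K^t V <=
  \<kappa> V, and \<open>dens\<close> times S_0(V) is at most 1. The bound does not depend on
  t.\<close>

lemma nn_integral_dens_wsum_V: "(\<integral>\<^sup>+ \<omega>. ennreal (dens \<omega>) * wsum t V \<omega> \<partial>M) \<le> \<kappa>"
proof -
  have "(\<integral>\<^sup>+ \<omega>. ennreal (dens \<omega>) * wsum t V \<omega> \<partial>M) = (\<integral>\<^sup>+ \<omega>. ennreal (dens \<omega>) * wsum 0 ((kop K ^^ t) V) \<omega> \<partial>M)"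
    using nn_integral_wsum_add[of "\<lambda>\<omega>. ennreal (dens \<omega>)" 0 V t] by simp
  also have "\<dots> \<le> (\<integral>\<^sup>+ \<omega>. \<kappa> \<partial>M)"
  proof (rule nn_integral_mono_AE)
    show "AE \<omega> in M. ennreal (dens \<omega>) * wsum 0 ((kop K ^^ t) V) \<omega> \<le> \<kappa>"
      using AE_wsum_0_V_finite AE_space
    proof eventually_elim
      fix \<omega> assume fin: "wsum 0 V \<omega> < \<infinity>" and \<omega>: "\<omega> \<in> space M"
      have "r ^ t \<le> 1"
        using r_pos r_less_1 by (intro power_le_one) auto
      then have r: "ennreal (R * r ^ t) \<le> ennreal R"
        using R_pos by (intro ennreal_leI) (simp add: mult_left_le)
      have "wsum 0 ((kop K ^^ t) V) \<omega> \<le> wsum 0 (\<lambda>x. \<kappa> * V x) \<omega>"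
      proof (rule wsum_mono_V[OF \<omega> fin])
        fix x assume x: "x \<in> space X" "V x < \<infinity>"
        have "(kop K ^^ t) V x = (\<integral>\<^sup>+ y. V y \<partial>kpow K X t x)"
          by (rule nn_integral_kpow[OF markov x(1) meas_V, symmetric])
        also have "\<dots> \<le> (\<integral>\<^sup>+ y. V y \<partial>\<mu>) * 1 + ennreal (R * r ^ t) * V x"
          using nn_integral_V_kpow[OF x] by simp
        also have "\<dots> \<le> (\<integral>\<^sup>+ y. V y \<partial>\<mu>) * V x + ennreal R * V x"
          by (intro add_mono mult_left_mono mult_right_mono V_ge_1 x r) auto
        finally show "(kop K ^^ t) V x \<le> \<kappa> * V x"
          by (simp add: \<kappa>_def distrib_right)
      qed
      then have "ennreal (dens \<omega>) * wsum 0 ((kop K ^^ t) V) \<omega> \<le> ennreal (dens \<omega>) * (\<kappa> * wsum 0 V \<omega>)"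
        unfolding wsum_cmult by (intro mult_left_mono) auto
      also have "\<dots> = \<kappa> * (ennreal (dens \<omega>) * wsum 0 V \<omega>)"
        by (simp add: mult_ac)
      also have "\<dots> \<le> \<kappa> * 1"
        by (intro mult_left_mono dens_wsum_0_V \<omega>) auto
      finally show "ennreal (dens \<omega>) * wsum 0 ((kop K ^^ t) V) \<omega> \<le> \<kappa>" by simp
    qed
  qed
  finally show ?thesis by (simp add: emeasure_space_1)
qed

lemma AE_wsum_V_finite: "AE \<omega> in M. wsum t V \<omega> < \<infinity>"
proof -
  have "AE \<omega> in M. ennreal (dens \<omega>) * wsum t V \<omega> \<noteq> \<infinity>"
    using nn_integral_dens_wsum_V[of t] \<kappa>_finite
    by (intro nn_integral_PInf_AE) (auto simp: top_unique)
  with AE_wsum_0_V_finite AE_space show ?thesis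
  proof eventually_elim
    case (elim \<omega>)
    then show ?case
      using dens_pos[of \<omega>] by (auto simp: ennreal_mult_eq_top_iff top.not_eq_extremum)
  qed
qed

section \<open>Second moments of the sums over particles\<close>

definition rsum :: "nat \<Rightarrow> ('a \<Rightarrow> real) \<Rightarrow> 'w \<Rightarrow> real" where
  "rsum t f \<omega> = (\<Sum>i<N t \<omega>. w t i \<omega> * f (xi t i \<omega>))"

lemma rsum_nonneg:
  assumes \<omega>: "\<omega> \<in> space M" and nonneg: "\<And>x. x \<in> space X \<Longrightarrow> 0 \<le> f x"
  shows "0 \<le> rsum t f \<omega>"
  unfolding rsum_def using w_nonneg[OF \<omega>] measurable_space[OF meas_xi] \<omega>
  by (intro sum_nonneg mult_nonneg_nonneg nonneg) auto

lemma ennreal_rsum: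
  assumes \<omega>: "\<omega> \<in> space M" and nonneg: "\<And>x. x \<in> space X \<Longrightarrow> 0 \<le> f x"
  shows "ennreal (rsum t f \<omega>) = wsum t (\<lambda>x. ennreal (f x)) \<omega>"
proof -
  have x: "xi t i \<omega> \<in> space X" for i
    using measurable_space[OF meas_xi] \<omega> by auto
  have "wsum t (\<lambda>x. ennreal (f x)) \<omega> = (\<Sum>i<N t \<omega>. ennreal (w t i \<omega> * f (xi t i \<omega>)))"
    unfolding wsum_def by (intro sum.cong) (auto simp: ennreal_mult w_nonneg \<omega> nonneg x)
  then show ?thesis
    unfolding rsum_def by (subst (asm) sum_ennreal) (auto intro!: mult_nonneg_nonneg w_nonneg \<omega> nonneg x)
qed

lemma measurable_rsum [measurable]:
  assumes [measurable]: "f \<in> borel_measurable X" and nonneg: "\<And>x. x \<in> space X \<Longrightarrow> 0 \<le> f x"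
  shows "rsum t f \<in> borel_measurable (F t)" "rsum t f \<in> borel_measurable M"
proof -
  have "(\<lambda>\<omega>. enn2real (wsum t (\<lambda>x. ennreal (f x)) \<omega>)) \<in> borel_measurable (F t)"
    by measurable
  then show "rsum t f \<in> borel_measurable (F t)"
    by (rule measurable_cong[THEN iffD1, rotated])
      (simp add: ennreal_rsum[symmetric] rsum_nonneg nonneg)
  then show "rsum t f \<in> borel_measurable M" by (rule measurable_F_M)
qed

text \<open>Jensen's inequality for the probability weights, obtained from the nonnegativity of the
  weighted variance about the mean \<open>a\<close>.\<close>

lemma rsum_square_le:
  assumes \<omega>: "\<omega> \<in> space M" and "weight t \<omega> = 1"
  shows "(rsum t f \<omega>)\<^sup>2 \<le> rsum t (\<lambda>x. (f x)\<^sup>2) \<omega>"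
proof -
  define a where "a = rsum t f \<omega>"
  have "0 \<le> (\<Sum>i<N t \<omega>. w t i \<omega> * (f (xi t i \<omega>) - a)\<^sup>2)"
    using w_nonneg[OF \<omega>] by (intro sum_nonneg mult_nonneg_nonneg) auto
  also have "\<dots> = (\<Sum>i<N t \<omega>. w t i \<omega> * (f (xi t i \<omega>))\<^sup>2 - 2 * a * (w t i \<omega> * f (xi t i \<omega>)) + a\<^sup>2 * w t i \<omega>)"
    by (intro sum.cong refl) (simp add: power2_eq_square algebra_simps)
  also have "\<dots> = rsum t (\<lambda>x. (f x)\<^sup>2) \<omega> - 2 * a * rsum t f \<omega> + a\<^sup>2 * weight t \<omega>"
    unfolding rsum_def weight_def by (simp add: sum.distrib sum_subtractf sum_distrib_left)
  also have "\<dots> = rsum t (\<lambda>x. (f x)\<^sup>2) \<omega> - a\<^sup>2"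
    using assms(2) by (simp add: a_def[symmetric] power2_eq_square)
  finally show ?thesis by (simp add: a_def)
qed

text \<open>Nonnegativity allows passing between real and extended sums, and it gives the monotone
  partial sums needed between squares. Functions of arbitrary sign are recovered at the end as
  differences.\<close>

definition dominated :: "real \<Rightarrow> ('a \<Rightarrow> real) \<Rightarrow> bool" where
  "dominated c f \<longleftrightarrow> 0 < c \<and> f \<in> borel_measurable X \<and>
     (\<forall>x\<in>space X. 0 \<le> f x \<and> ennreal ((f x)\<^sup>2) \<le> ennreal c * V x)"

lemma dominatedD:
  assumes "dominated c f"
  shows "0 < c" "f \<in> borel_measurable X" "x \<in> space X \<Longrightarrow> 0 \<le> f x"
    "x \<in> space X \<Longrightarrow> ennreal ((f x)\<^sup>2) \<le> ennreal c * V x"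
  using assms by (auto simp: dominated_def)

abbreviation sqrtV :: "'a \<Rightarrow> real" where
  "sqrtV x \<equiv> sqrt (enn2real (V x))"

text \<open>The error of K^n f is a multiple of \<open>sqrtV\<close>, so its sums need second
  moments too. Where V is infinite, \<open>enn2real\<close> gives 0 and the domination is
  trivial.\<close>

lemma dominated_sqrtV: "dominated 1 sqrtV"
  unfolding dominated_def by (auto intro: ennreal_enn2real_if[THEN eq_refl, THEN order_trans] simp: ennreal_enn2real_if)

lemma dominated_one: "dominated 1 (\<lambda>_. 1)"
  unfolding dominated_def by (auto simp: V_ge_1)

text \<open>The rate for test functions of order sqrt V, as their error is sqrt (r^t V).\<close>

abbreviation q :: real where "q \<equiv> sqrt r"

lemma q_bounds: "0 < q" "q < 1"
  using r_pos r_less_1 by auto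

text \<open>The absolute value in \<open>integral_kpow_sqrt_V\<close> is split into two additive
  bounds because subtraction of extended nonnegative numbers truncates at 0. The upper one serves
  products of sums, the lower one their means.\<close>

lemma kop_funpow_sqrt_V:
  fixes f :: "'a \<Rightarrow> real" and n :: nat
  assumes f: "dominated c f" and x: "x \<in> space X" "V x < \<infinity>"
  defines "d \<equiv> ennreal ((1 + c * R) * q ^ n) * ennreal (sqrtV x)"
  shows "(kop K ^^ n) (\<lambda>x. ennreal (f x)) x \<le> ennreal (\<integral>y. f y \<partial>\<mu>) + d"
    and "ennreal (\<integral>y. f y \<partial>\<mu>) \<le> (kop K ^^ n) (\<lambda>x. ennreal (f x)) x + d"
proof -
  let ?P = "kpow K X n x"
  note [measurable] = dominatedD(2)[OF f]
  have sets_P: "sets ?P = sets X" and space_P: "space ?P = space X" and prob_P: "prob_space ?P"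
    by (rule kpowD[OF markov x(1)])+
  have c: "0 < c" by (rule dominatedD(1)[OF f])
  have "(\<integral>\<^sup>+ y. V y \<partial>?P) < \<infinity>"
    using V_\<mu> x(2) by (auto intro!: le_less_trans[OF nn_integral_V_kpow[OF x, of n]] simp: ennreal_mult_less_top)
  then have "integrable ?P f"
    by (rule integrable_sqrt_V[OF prob_P sets_P _ dominatedD(2,4)[OF f]])
  then have "(\<integral>\<^sup>+ y. ennreal (f y) \<partial>?P) = ennreal (\<integral>y. f y \<partial>?P)"
    by (rule nn_integral_eq_integral) (use dominatedD(3)[OF f] space_P in auto)
  then have P: "(kop K ^^ n) (\<lambda>x. ennreal (f x)) x = ennreal (\<integral>y. f y \<partial>?P)"
    using nn_integral_kpow[OF markov x(1), of "\<lambda>x. ennreal (f x)" n] by simp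
  have nonneg: "0 \<le> (\<integral>y. f y \<partial>?P)" "0 \<le> (\<integral>y. f y \<partial>\<mu>)"
    using dominatedD(3)[OF f] space_P sets_eq_imp_space_eq[OF sets_\<mu>]
    by (auto intro!: Bochner_Integration.integral_nonneg_AE)
  define e where "e = (1 + c * R) * q ^ n * sqrtV x"
  have e: "0 \<le> e" "d = ennreal e"
    using c R_pos r_pos by (auto simp: e_def d_def ennreal_mult)
  have "\<bar>(\<integral>y. f y \<partial>?P) - (\<integral>y. f y \<partial>\<mu>)\<bar> \<le> e"
    using integral_kpow_sqrt_V[OF dominatedD(2,3)[OF f] c dominatedD(4)[OF f] x, of n]
    by (simp add: e_def real_sqrt_mult real_sqrt_power mult_ac)
  then have "(\<integral>y. f y \<partial>?P) \<le> (\<integral>y. f y \<partial>\<mu>) + e" "(\<integral>y. f y \<partial>\<mu>) \<le> (\<integral>y. f y \<partial>?P) + e"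
    by linarith+
  then show "(kop K ^^ n) (\<lambda>x. ennreal (f x)) x \<le> ennreal (\<integral>y. f y \<partial>\<mu>) + d"
    and "ennreal (\<integral>y. f y \<partial>\<mu>) \<le> (kop K ^^ n) (\<lambda>x. ennreal (f x)) x + d"
    unfolding P e(2) using e(1) nonneg by (metis ennreal_leI ennreal_plus)+
qed

lemma AE_weight_1: "AE \<omega> in M. weight t \<omega> = 1"
  using weight_1 by eventually_elim simp

lemma rsum_one: "rsum t (\<lambda>_. 1) \<omega> = weight t \<omega>"
  by (simp add: rsum_def weight_def)

lemma ennreal_rsum_square_le:
  assumes f: "dominated c f" and \<omega>: "\<omega> \<in> space M" "weight t \<omega> = 1"
  shows "ennreal ((rsum t f \<omega>)\<^sup>2) \<le> ennreal c * wsum t V \<omega>"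
proof -
  have "ennreal ((rsum t f \<omega>)\<^sup>2) \<le> ennreal (rsum t (\<lambda>x. (f x)\<^sup>2) \<omega>)"
    by (intro ennreal_leI rsum_square_le \<omega>)
  also have "\<dots> = wsum t (\<lambda>x. ennreal ((f x)\<^sup>2)) \<omega>"
    by (rule ennreal_rsum[OF \<omega>(1)]) simp
  also have "\<dots> \<le> wsum t (\<lambda>x. ennreal c * V x) \<omega>"
    unfolding wsum_def using measurable_space[OF meas_xi] \<omega>(1)
    by (intro sum_mono mult_left_mono dominatedD(4)[OF f]) auto
  finally show ?thesis by (simp add: wsum_cmult)
qed

text \<open>From S T <= S^2 + T^2, Jensen's inequality for each square, and the bound \<kappa> on
  the weighted means of S_s(V) and S_t(V). The result is uniform in s and t.\<close>

lemma
  assumes f: "dominated c f" and g: "dominated d g"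
  shows integrable_rsum_prod: "integrable M (\<lambda>\<omega>. dens \<omega> * (rsum s f \<omega> * rsum t g \<omega>))"
    and expectation_rsum_prod: "expectation (\<lambda>\<omega>. dens \<omega> * (rsum s f \<omega> * rsum t g \<omega>)) \<le> (c + d) * enn2real \<kappa>"
proof -
  note [measurable] = measurable_rsum[OF dominatedD(2,3)[OF f]] measurable_rsum[OF dominatedD(2,3)[OF g]]
  have nonneg: "0 \<le> dens \<omega> * (rsum s f \<omega> * rsum t g \<omega>)" if "\<omega> \<in> space M" for \<omega>
    using that by (intro mult_nonneg_nonneg dens_bounds rsum_nonneg dominatedD(3)[OF f] dominatedD(3)[OF g])
  have "(\<integral>\<^sup>+ \<omega>. ennreal (dens \<omega> * (rsum s f \<omega> * rsum t g \<omega>)) \<partial>M)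
      \<le> (\<integral>\<^sup>+ \<omega>. ennreal c * (ennreal (dens \<omega>) * wsum s V \<omega>) + ennreal d * (ennreal (dens \<omega>) * wsum t V \<omega>) \<partial>M)"
  proof (rule nn_integral_mono_AE)
    show "AE \<omega> in M. ennreal (dens \<omega> * (rsum s f \<omega> * rsum t g \<omega>))
        \<le> ennreal c * (ennreal (dens \<omega>) * wsum s V \<omega>) + ennreal d * (ennreal (dens \<omega>) * wsum t V \<omega>)"
      using AE_weight_1[of s] AE_weight_1[of t] AE_space
    proof eventually_elim
      fix \<omega> assume w1: "weight s \<omega> = 1" "weight t \<omega> = 1" and \<omega>: "\<omega> \<in> space M"
      let ?S = "rsum s f \<omega>" and ?T = "rsum t g \<omega>"
      have "?S * ?T \<le> ?S\<^sup>2 + ?T\<^sup>2"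
        using sum_squares_bound[of ?S ?T] sum_power2_ge_zero[of ?S ?T] unfolding mult.assoc by linarith
      then have "dens \<omega> * (?S * ?T) \<le> dens \<omega> * (?S\<^sup>2 + ?T\<^sup>2)"
        by (intro mult_left_mono dens_bounds)
      then have "ennreal (dens \<omega> * (?S * ?T)) \<le> ennreal (dens \<omega> * (?S\<^sup>2 + ?T\<^sup>2))"
        by (rule ennreal_leI)
      also have "\<dots> = ennreal (dens \<omega>) * ennreal (?S\<^sup>2) + ennreal (dens \<omega>) * ennreal (?T\<^sup>2)"
        using dens_bounds[of \<omega>] by (subst ennreal_mult) (auto simp: distrib_left)
      also have "\<dots> \<le> ennreal (dens \<omega>) * (ennreal c * wsum s V \<omega>) + ennreal (dens \<omega>) * (ennreal d * wsum t V \<omega>)"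
        by (intro add_mono mult_left_mono ennreal_rsum_square_le f g \<omega> w1) auto
      finally show "ennreal (dens \<omega> * (?S * ?T))
          \<le> ennreal c * (ennreal (dens \<omega>) * wsum s V \<omega>) + ennreal d * (ennreal (dens \<omega>) * wsum t V \<omega>)"
        by (simp add: mult.left_commute)
    qed
  qed
  also have "\<dots> = ennreal c * (\<integral>\<^sup>+ \<omega>. ennreal (dens \<omega>) * wsum s V \<omega> \<partial>M)
      + ennreal d * (\<integral>\<^sup>+ \<omega>. ennreal (dens \<omega>) * wsum t V \<omega> \<partial>M)"
    by (subst nn_integral_add) (auto simp: nn_integral_cmult)
  also have "\<dots> \<le> ennreal c * \<kappa> + ennreal d * \<kappa>"
    by (intro add_mono mult_left_mono nn_integral_dens_wsum_V) auto
  also have "\<dots> = ennreal ((c + d) * enn2real \<kappa>)"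
    using \<kappa>_finite dominatedD(1)[OF f] dominatedD(1)[OF g]
    by (cases \<kappa>) (auto simp: ennreal_mult[symmetric] distrib_right)
  finally have le: "(\<integral>\<^sup>+ \<omega>. ennreal (dens \<omega> * (rsum s f \<omega> * rsum t g \<omega>)) \<partial>M) \<le> ennreal ((c + d) * enn2real \<kappa>)" .
  show int: "integrable M (\<lambda>\<omega>. dens \<omega> * (rsum s f \<omega> * rsum t g \<omega>))"
    by (rule integrableI_nonneg) (use le nonneg in \<open>auto intro: le_less_trans\<close>)
  have "0 \<le> (c + d) * enn2real \<kappa>"
    using dominatedD(1)[OF f] dominatedD(1)[OF g] by simp
  with le show "expectation (\<lambda>\<omega>. dens \<omega> * (rsum s f \<omega> * rsum t g \<omega>)) \<le> (c + d) * enn2real \<kappa>"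
    by (subst (asm) nn_integral_eq_integral[OF int]) (use nonneg in auto)
qed

lemma integrable_dens: "integrable M dens"
  by (rule integrable_const_bound[of _ 1]) (auto simp: dens_bounds dens_le_1)

text \<open>Almost surely S_t(1) = 1, so a single sum is a product of two dominated ones.\<close>

lemma integrable_dens_rsum:
  assumes f: "dominated c f"
  shows "integrable M (\<lambda>\<omega>. dens \<omega> * rsum t f \<omega>)"
proof -
  note [measurable] = measurable_rsum[OF dominatedD(2,3)[OF f]]
  have "AE \<omega> in M. dens \<omega> * (rsum t f \<omega> * rsum t (\<lambda>_. 1) \<omega>) = dens \<omega> * rsum t f \<omega>"
    using AE_weight_1[of t] by eventually_elim (simp add: rsum_one)
  with integrable_rsum_prod[OF f dominated_one, of t t] show ?thesis
    by (subst (asm) integrable_cong_AE) (auto simp: rsum_one[abs_def])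
qed

section \<open>Decay of covariances\<close>

text \<open>A lower bound, since these means enter the covariance with the coefficient - \<mu>(f) <=
  0. Moving all transitions back to time 0 leaves an error of order \<open>sqrtV\<close>, which is
  at most V and is absorbed by \<open>dens_wsum_0_V\<close>.\<close>

lemma expectation_rsum_ge:
  assumes f: "dominated c f"
  shows "(\<integral>x. f x \<partial>\<mu>) * expectation dens \<le> expectation (\<lambda>\<omega>. dens \<omega> * rsum t f \<omega>) + (1 + c * R) * q ^ t"
proof -
  note [measurable] = dominatedD(2)[OF f]
  define m where "m = (\<integral>x. f x \<partial>\<mu>)"
  define b where "b = (1 + c * R) * q ^ t"
  have m: "0 \<le> m"
    using dominatedD(3)[OF f] sets_eq_imp_space_eq[OF sets_\<mu>]
    by (auto simp: m_def intro!: Bochner_Integration.integral_nonneg_AE)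
  have b: "0 \<le> b"
    using dominatedD(1)[OF f] R_pos r_pos by (simp add: b_def)
  have a: "0 \<le> expectation (\<lambda>\<omega>. dens \<omega> * rsum t f \<omega>)"
    by (intro Bochner_Integration.integral_nonneg_AE AE_I2 mult_nonneg_nonneg dens_bounds rsum_nonneg dominatedD(3)[OF f])
  have "ennreal (m * expectation dens) = (\<integral>\<^sup>+ \<omega>. ennreal m * ennreal (dens \<omega>) \<partial>M)"
    using m by (simp add: ennreal_mult nn_integral_cmult nn_integral_eq_integral[OF integrable_dens] dens_bounds)
  also have "\<dots> \<le> (\<integral>\<^sup>+ \<omega>. ennreal (dens \<omega>) * wsum 0 ((kop K ^^ t) (\<lambda>x. ennreal (f x))) \<omega> + ennreal b \<partial>M)"
  proof (rule nn_integral_mono_AE)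
    show "AE \<omega> in M. ennreal m * ennreal (dens \<omega>)
        \<le> ennreal (dens \<omega>) * wsum 0 ((kop K ^^ t) (\<lambda>x. ennreal (f x))) \<omega> + ennreal b"
      using AE_wsum_V_finite[of 0] AE_space
    proof eventually_elim
      fix \<omega> assume fin: "wsum 0 V \<omega> < \<infinity>" and \<omega>: "\<omega> \<in> space M"
      have "ennreal m = wsum 0 (\<lambda>_. ennreal m) \<omega>"
        by (simp add: wsum_const \<omega> weight_0)
      also have "\<dots> \<le> wsum 0 (\<lambda>x. (kop K ^^ t) (\<lambda>x. ennreal (f x)) x + ennreal b * V x) \<omega>"
      proof (rule wsum_mono_V[OF \<omega> fin])
        fix x assume x: "x \<in> space X" "V x < \<infinity>"
        have "ennreal (sqrtV x) \<le> V x"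
          using V_ge_1[OF x(1)] x(2)
          by (cases "V x") (auto intro!: ennreal_leI real_le_lsqrt self_le_power)
        then have "ennreal b * ennreal (sqrtV x) \<le> ennreal b * V x"
          by (rule mult_left_mono) simp
        then show "ennreal m \<le> (kop K ^^ t) (\<lambda>x. ennreal (f x)) x + ennreal b * V x"
          using kop_funpow_sqrt_V(2)[OF f x, of t] unfolding b_def m_def
          by (meson add_left_mono order_trans)
      qed
      also have "\<dots> = wsum 0 ((kop K ^^ t) (\<lambda>x. ennreal (f x))) \<omega> + ennreal b * wsum 0 V \<omega>"
        by (simp add: wsum_add wsum_cmult)
      finally have "ennreal (dens \<omega>) * ennreal m \<le> ennreal (dens \<omega>) * \<dots>"
        by (rule mult_left_mono) simp
      also have "\<dots> = ennreal (dens \<omega>) * wsum 0 ((kop K ^^ t) (\<lambda>x. ennreal (f x))) \<omega>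
          + ennreal b * (ennreal (dens \<omega>) * wsum 0 V \<omega>)"
        by (simp add: distrib_left mult_ac)
      also have "\<dots> \<le> ennreal (dens \<omega>) * wsum 0 ((kop K ^^ t) (\<lambda>x. ennreal (f x))) \<omega> + ennreal b * 1"
        by (intro add_left_mono mult_left_mono dens_wsum_0_V \<omega>) auto
      finally show "ennreal m * ennreal (dens \<omega>)
          \<le> ennreal (dens \<omega>) * wsum 0 ((kop K ^^ t) (\<lambda>x. ennreal (f x))) \<omega> + ennreal b"
        by (simp add: mult.commute)
    qed
  qed
  also have "\<dots> = (\<integral>\<^sup>+ \<omega>. ennreal (dens \<omega>) * wsum 0 ((kop K ^^ t) (\<lambda>x. ennreal (f x))) \<omega> \<partial>M) + ennreal b"
    by (subst nn_integral_add) (auto simp: emeasure_space_1 intro!: borel_measurable_times_ennreal measurable_wsum_M measurable_kop_funpow markov)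
  also have "(\<integral>\<^sup>+ \<omega>. ennreal (dens \<omega>) * wsum 0 ((kop K ^^ t) (\<lambda>x. ennreal (f x))) \<omega> \<partial>M)
      = (\<integral>\<^sup>+ \<omega>. ennreal (dens \<omega>) * wsum t (\<lambda>x. ennreal (f x)) \<omega> \<partial>M)"
    using nn_integral_wsum_add[of "\<lambda>\<omega>. ennreal (dens \<omega>)" 0 "\<lambda>x. ennreal (f x)" t] by simp
  also have "\<dots> = (\<integral>\<^sup>+ \<omega>. ennreal (dens \<omega> * rsum t f \<omega>) \<partial>M)"
    by (intro nn_integral_cong) (simp add: ennreal_mult dens_bounds rsum_nonneg ennreal_rsum dominatedD(3)[OF f])
  also have "\<dots> = ennreal (expectation (\<lambda>\<omega>. dens \<omega> * rsum t f \<omega>))"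
    by (rule nn_integral_eq_integral[OF integrable_dens_rsum[OF f]])
      (simp add: dens_bounds rsum_nonneg dominatedD(3)[OF f])
  finally show ?thesis
    unfolding m_def[symmetric] b_def[symmetric]
    using a b by (simp flip: ennreal_plus)
qed

text \<open>Moving n transitions back to time s replaces f by K^n f, which is at most \<mu>(f) plus
  a multiple of q^n \<open>sqrtV\<close>. Here an error of order \<open>sqrtV\<close> rather than V
  is decisive: its product with S_s(f) is controlled by a first moment of V.\<close>

lemma expectation_rsum_rsum_le:
  assumes f: "dominated c f"
  shows "expectation (\<lambda>\<omega>. dens \<omega> * (rsum s f \<omega> * rsum (s + n) f \<omega>))
    \<le> (\<integral>x. f x \<partial>\<mu>) * expectation (\<lambda>\<omega>. dens \<omega> * rsum s f \<omega>) + (1 + c * R) * q ^ n * ((c + 1) * enn2real \<kappa>)"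
proof -
  note [measurable] = dominatedD(2)[OF f] measurable_rsum[OF dominatedD(2,3)[OF f]]
    measurable_rsum[OF dominatedD(2,3)[OF dominated_sqrtV]]
  define m where "m = (\<integral>x. f x \<partial>\<mu>)"
  define b where "b = (1 + c * R) * q ^ n"
  let ?f = "\<lambda>x. ennreal (f x)"
  have m: "0 \<le> m"
    using dominatedD(3)[OF f] sets_eq_imp_space_eq[OF sets_\<mu>]
    by (auto simp: m_def intro!: Bochner_Integration.integral_nonneg_AE)
  have b: "0 \<le> b"
    using dominatedD(1)[OF f] R_pos r_pos by (simp add: b_def)
  have nn: "0 \<le> dens \<omega> * rsum s f \<omega>" if "\<omega> \<in> space M" for \<omega>
    using that by (intro mult_nonneg_nonneg dens_bounds rsum_nonneg dominatedD(3)[OF f])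
  have [measurable]: "dens \<in> borel_measurable (F s)"
    by (rule measurable_from_subalg[OF subalg_F_mono measurable_dens(1)]) simp
  define B where "B \<omega> = m * (dens \<omega> * rsum s f \<omega>) + b * (dens \<omega> * (rsum s f \<omega> * rsum s sqrtV \<omega>))" for \<omega>
  have int_B: "integrable M B"
    unfolding B_def
    by (intro Bochner_Integration.integrable_add integrable_mult_right integrable_dens_rsum[OF f]
        integrable_rsum_prod[OF f dominated_sqrtV])
  have nonneg_B: "0 \<le> B \<omega>" if "\<omega> \<in> space M" for \<omega>
    unfolding B_def using that
    by (intro add_nonneg_nonneg mult_nonneg_nonneg m b dens_bounds rsum_nonneg dominatedD(3)[OF f] dominatedD(3)[OF dominated_sqrtV])
  have "ennreal (expectation (\<lambda>\<omega>. dens \<omega> * (rsum s f \<omega> * rsum (s + n) f \<omega>)))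
      = (\<integral>\<^sup>+ \<omega>. ennreal (dens \<omega> * (rsum s f \<omega> * rsum (s + n) f \<omega>)) \<partial>M)"
    by (rule nn_integral_eq_integral[symmetric, OF integrable_rsum_prod[OF f f]])
      (simp add: dens_bounds rsum_nonneg dominatedD(3)[OF f])
  also have "\<dots> = (\<integral>\<^sup>+ \<omega>. ennreal (dens \<omega> * rsum s f \<omega>) * wsum (s + n) ?f \<omega> \<partial>M)"
    by (intro nn_integral_cong)
      (simp add: ennreal_rsum[symmetric] dominatedD(3)[OF f] ennreal_mult[symmetric] nn rsum_nonneg mult.assoc)
  also have "\<dots> = (\<integral>\<^sup>+ \<omega>. ennreal (dens \<omega> * rsum s f \<omega>) * wsum s ((kop K ^^ n) ?f) \<omega> \<partial>M)"
    by (rule nn_integral_wsum_add) measurable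
  also have "\<dots> \<le> (\<integral>\<^sup>+ \<omega>. ennreal (B \<omega>) \<partial>M)"
  proof (rule nn_integral_mono_AE)
    show "AE \<omega> in M. ennreal (dens \<omega> * rsum s f \<omega>) * wsum s ((kop K ^^ n) ?f) \<omega> \<le> ennreal (B \<omega>)"
      using AE_wsum_V_finite[of s] AE_weight_1[of s] AE_space
    proof eventually_elim
      fix \<omega> assume fin: "wsum s V \<omega> < \<infinity>" and w1: "weight s \<omega> = 1" and \<omega>: "\<omega> \<in> space M"
      have "wsum s ((kop K ^^ n) ?f) \<omega> \<le> wsum s (\<lambda>x. ennreal m + ennreal b * ennreal (sqrtV x)) \<omega>"
        using kop_funpow_sqrt_V(1)[OF f] unfolding m_def b_def by (intro wsum_mono_V[OF \<omega> fin])
      also have "\<dots> = ennreal m + ennreal b * ennreal (rsum s sqrtV \<omega>)"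
        by (simp add: wsum_add wsum_cmult wsum_const \<omega> w1 ennreal_rsum)
      also have "\<dots> = ennreal (m + b * rsum s sqrtV \<omega>)"
        using m b rsum_nonneg[OF \<omega>, of sqrtV s] by (simp add: ennreal_mult)
      finally have "ennreal (dens \<omega> * rsum s f \<omega>) * wsum s ((kop K ^^ n) ?f) \<omega>
          \<le> ennreal (dens \<omega> * rsum s f \<omega>) * ennreal (m + b * rsum s sqrtV \<omega>)"
        by (rule mult_left_mono) simp
      also have "\<dots> = ennreal (B \<omega>)"
        using m b rsum_nonneg[OF \<omega>, of sqrtV s] nn[OF \<omega>]
        by (subst ennreal_mult[symmetric]) (auto simp: B_def algebra_simps)
      finally show "ennreal (dens \<omega> * rsum s f \<omega>) * wsum s ((kop K ^^ n) ?f) \<omega> \<le> ennreal (B \<omega>)" .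
    qed
  qed
  also have "\<dots> = ennreal (expectation B)"
    by (rule nn_integral_eq_integral[OF int_B]) (simp add: nonneg_B)
  finally have "expectation (\<lambda>\<omega>. dens \<omega> * (rsum s f \<omega> * rsum (s + n) f \<omega>)) \<le> expectation B"
    by (subst (asm) ennreal_le_iff) (auto intro!: Bochner_Integration.integral_nonneg_AE nonneg_B)
  also have "\<dots> = m * expectation (\<lambda>\<omega>. dens \<omega> * rsum s f \<omega>)
      + b * expectation (\<lambda>\<omega>. dens \<omega> * (rsum s f \<omega> * rsum s sqrtV \<omega>))"
    unfolding B_def
    by (simp add: integrable_dens_rsum[OF f] integrable_rsum_prod[OF f dominated_sqrtV])
  also have "\<dots> \<le> m * expectation (\<lambda>\<omega>. dens \<omega> * rsum s f \<omega>) + b * ((c + 1) * enn2real \<kappa>)"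
    by (intro add_left_mono mult_left_mono b expectation_rsum_prod f dominated_sqrtV)
  finally show ?thesis
    unfolding m_def b_def .
qed

text \<open>Enlarging T by one adds twice the covariances with the earlier times and one diagonal
  term. Geometric decay bounds this increment independently of T, hence the growth is at most
  linear.\<close>

lemma expectation_sum_square_le:
  assumes f: "dominated c f"
  obtains D where "\<And>T. expectation (\<lambda>\<omega>. dens \<omega> * (\<Sum>t<T. rsum t f \<omega> - (\<integral>x. f x \<partial>\<mu>))\<^sup>2) \<le> D * real T"
    "\<And>T. integrable M (\<lambda>\<omega>. dens \<omega> * (\<Sum>t<T. rsum t f \<omega> - (\<integral>x. f x \<partial>\<mu>))\<^sup>2)"
proof -
  define m where "m = (\<integral>x. f x \<partial>\<mu>)"
  define b where "b = 1 + c * R"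
  \<comment> \<open>The first summand is the error in the mean of the product, the second comes from
    the lower bound for the mean at the later time.\<close>
  define D where "D = b * ((c + 1) * enn2real \<kappa>) + m * b"
  define Y where "Y t \<omega> = rsum t f \<omega> - m" for t \<omega>
  have m: "0 \<le> m"
    using dominatedD(3)[OF f] sets_eq_imp_space_eq[OF sets_\<mu>]
    by (auto simp: m_def intro!: Bochner_Integration.integral_nonneg_AE)
  have b: "0 \<le> b"
    using dominatedD(1)[OF f] R_pos by (simp add: b_def)
  have D: "0 \<le> D"
    using b m dominatedD(1)[OF f] by (simp add: D_def)
  have Y_eq: "dens \<omega> * (Y s \<omega> * Y t \<omega>) = dens \<omega> * (rsum s f \<omega> * rsum t f \<omega>) - m * (dens \<omega> * rsum s f \<omega>)
      - m * (dens \<omega> * rsum t f \<omega>) + m * m * dens \<omega>" for s t \<omega>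
    by (simp add: Y_def algebra_simps)
  note int = integrable_rsum_prod[OF f f] integrable_dens_rsum[OF f] integrable_dens
  have int_Y: "integrable M (\<lambda>\<omega>. dens \<omega> * (Y s \<omega> * Y t \<omega>))" for s t
    unfolding Y_eq by (simp add: int)
  \<comment> \<open>The leading term m \<open>?a s\<close> of the product cancels. What remains is m
    times the gap between m \<open>expectation dens\<close> and \<open>?a (s + n)\<close>, bounded
    with rate q^(s+n), which is at most q^n.\<close>
  have cov: "expectation (\<lambda>\<omega>. dens \<omega> * (Y s \<omega> * Y (s + n) \<omega>)) \<le> D * q ^ n" for s n
  proof -
    let ?a = "\<lambda>t. expectation (\<lambda>\<omega>. dens \<omega> * rsum t f \<omega>)"
    have "expectation (\<lambda>\<omega>. dens \<omega> * (Y s \<omega> * Y (s + n) \<omega>))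
        = expectation (\<lambda>\<omega>. dens \<omega> * (rsum s f \<omega> * rsum (s + n) f \<omega>)) - m * ?a s - m * ?a (s + n) + m * (m * expectation dens)"
      unfolding Y_eq by (simp add: int)
    moreover have "m * (m * expectation dens) \<le> m * (?a (s + n) + b * q ^ (s + n))"
      using expectation_rsum_ge[OF f, of "s + n"] by (intro mult_left_mono m) (simp add: m_def b_def)
    moreover have "expectation (\<lambda>\<omega>. dens \<omega> * (rsum s f \<omega> * rsum (s + n) f \<omega>))
        \<le> m * ?a s + b * q ^ n * ((c + 1) * enn2real \<kappa>)"
      using expectation_rsum_rsum_le[OF f, of s n] by (simp add: m_def b_def)
    moreover have "m * (b * q ^ (s + n)) \<le> m * (b * q ^ n)"
      using q_bounds by (intro mult_left_mono m b power_decreasing) auto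
    ultimately show ?thesis
      by (simp add: D_def distrib_left distrib_right mult_ac)
  qed
  have sq: "dens \<omega> * (\<Sum>t<Suc T. Y t \<omega>)\<^sup>2 = dens \<omega> * (\<Sum>t<T. Y t \<omega>)\<^sup>2
      + (2 * (\<Sum>t<T. dens \<omega> * (Y t \<omega> * Y T \<omega>)) + dens \<omega> * (Y T \<omega> * Y T \<omega>))" for T \<omega>
    by (simp add: power2_eq_square algebra_simps sum_distrib_left sum_distrib_right)
  have int_S: "integrable M (\<lambda>\<omega>. dens \<omega> * (\<Sum>t<T. Y t \<omega>)\<^sup>2)" for T
  proof (induction T)
    case (Suc T)
    then show ?case
      unfolding sq by (intro Bochner_Integration.integrable_add integrable_mult_right Bochner_Integration.integrable_sum int_Y)
  qed simp
  define Q where "Q = q / (1 - q)"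
  define E where "E = 2 * (D * Q) + D"
  have "expectation (\<lambda>\<omega>. dens \<omega> * (\<Sum>t<T. Y t \<omega>)\<^sup>2) \<le> E * real T" for T
  proof (induction T)
    case (Suc T)
    have "expectation (\<lambda>\<omega>. dens \<omega> * (\<Sum>t<Suc T. Y t \<omega>)\<^sup>2)
        = expectation (\<lambda>\<omega>. dens \<omega> * (\<Sum>t<T. Y t \<omega>)\<^sup>2)
          + (2 * (\<Sum>t<T. expectation (\<lambda>\<omega>. dens \<omega> * (Y t \<omega> * Y T \<omega>))) + expectation (\<lambda>\<omega>. dens \<omega> * (Y T \<omega> * Y T \<omega>)))"
      unfolding sq using int_S[of T] by (simp add: int_Y)
    also have "(\<Sum>t<T. expectation (\<lambda>\<omega>. dens \<omega> * (Y t \<omega> * Y T \<omega>))) \<le> (\<Sum>t<T. D * q ^ (T - t))"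
    proof (rule sum_mono)
      fix t assume "t \<in> {..<T}"
      then show "expectation (\<lambda>\<omega>. dens \<omega> * (Y t \<omega> * Y T \<omega>)) \<le> D * q ^ (T - t)"
        using cov[of t "T - t"] by simp
    qed
    also have "(\<Sum>t<T. D * q ^ (T - t)) \<le> D * Q"
      unfolding Q_def sum_distrib_left[symmetric]
      using q_bounds by (intro mult_left_mono D sum_geometric_le) auto
    also have "expectation (\<lambda>\<omega>. dens \<omega> * (Y T \<omega> * Y T \<omega>)) \<le> D"
      using cov[of T 0] by simp
    also note Suc.IH
    finally show ?case
      by (simp add: E_def algebra_simps)
  qed simp
  with int_S show ?thesis
    unfolding Y_def m_def by (rule that[rotated])
qed

section \<open>Almost sure convergence of the averages\<close>

lemma AE_averages_dominated:
  assumes f: "dominated c f"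
  shows "AE \<omega> in M. (\<lambda>T. (1 / real T) * (\<Sum>t<T. rsum t f \<omega>)) \<longlonglongrightarrow> (\<integral>x. f x \<partial>\<mu>)"
proof -
  note [measurable] = measurable_rsum[OF dominatedD(2,3)[OF f]]
  define m where "m = (\<integral>x. f x \<partial>\<mu>)"
  define S where "S T \<omega> = (\<Sum>t<T. rsum t f \<omega> - m)" for T \<omega>
  obtain D where D: "\<And>T. expectation (\<lambda>\<omega>. dens \<omega> * (S T \<omega>)\<^sup>2) \<le> D * real T"
    and int: "\<And>T. integrable M (\<lambda>\<omega>. dens \<omega> * (S T \<omega>)\<^sup>2)"
    using expectation_sum_square_le[OF f] unfolding S_def m_def by blast
  define G where "G k \<omega> = dens \<omega> * (S ((Suc k)\<^sup>2) \<omega> / real ((Suc k)\<^sup>2))\<^sup>2" for k \<omega>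
  have [measurable]: "G k \<in> borel_measurable M" for k
    unfolding G_def S_def by measurable
  have G_nonneg: "0 \<le> G k \<omega>" for k \<omega>
    by (simp add: G_def dens_bounds)
  have G_eq: "G k \<omega> = (dens \<omega> * (S ((Suc k)\<^sup>2) \<omega>)\<^sup>2) / (real ((Suc k)\<^sup>2))\<^sup>2" for k \<omega>
    by (simp add: G_def power_divide)
  have int_G: "integrable M (G k)" for k
    unfolding G_eq[abs_def] by (intro integrable_divide_zero int)
  \<comment> \<open>Linear growth over (k+1)^2 times, divided by (k+1)^4, leaves the summable order
    1 / (k+1)^2. The constant D comes without a sign, hence its absolute value.\<close>
  have E_G: "expectation (G k) \<le> \<bar>D\<bar> * (1 / (real (Suc k))\<^sup>2)" for k
  proof -
    have "expectation (G k) = expectation (\<lambda>\<omega>. dens \<omega> * (S ((Suc k)\<^sup>2) \<omega>)\<^sup>2) / (real ((Suc k)\<^sup>2))\<^sup>2"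
      unfolding G_eq[abs_def] by (rule integral_divide_zero)
    also have "\<dots> \<le> (\<bar>D\<bar> * real ((Suc k)\<^sup>2)) / (real ((Suc k)\<^sup>2))\<^sup>2"
      by (intro divide_right_mono order_trans[OF D] mult_right_mono) auto
    also have "\<dots> = \<bar>D\<bar> * (1 / (real (Suc k))\<^sup>2)"
      unfolding of_nat_power by (simp add: power2_eq_square del: of_nat_Suc of_nat_mult)
    finally show ?thesis .
  qed
  have sum: "summable (\<lambda>k. \<bar>D\<bar> * (1 / (real (Suc k))\<^sup>2))"
    using summable_Suc_iff[of "\<lambda>n. inverse (real n ^ 2)"] inverse_power_summable[of 2, where ?'a = real]
    by (intro summable_mult) (simp add: inverse_eq_divide)
  \<comment> \<open>Borel-Cantelli without events: the sum of the nonnegative \<open>G k\<close> has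
    finite mean, so it is almost surely finite and its terms tend to 0. Dividing by the positive
    \<open>dens\<close> then removes the density.\<close>
  have "(\<integral>\<^sup>+ \<omega>. (\<Sum>k. ennreal (G k \<omega>)) \<partial>M) = (\<Sum>k. \<integral>\<^sup>+ \<omega>. ennreal (G k \<omega>) \<partial>M)"
    by (rule nn_integral_suminf) measurable
  also have "\<dots> = (\<Sum>k. ennreal (expectation (G k)))"
    by (intro suminf_cong nn_integral_eq_integral int_G) (simp add: G_nonneg)
  also have "\<dots> \<le> (\<Sum>k. ennreal (\<bar>D\<bar> * (1 / (real (Suc k))\<^sup>2)))"
    by (intro suminf_le ennreal_leI E_G) auto
  also have "\<dots> < \<infinity>"
    using sum by (subst suminf_ennreal2) auto
  finally have "AE \<omega> in M. (\<Sum>k. ennreal (G k \<omega>)) \<noteq> \<infinity>"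
    by (intro nn_integral_PInf_AE) auto
  with AE_wsum_0_V_finite AE_space show ?thesis
  proof eventually_elim
    fix \<omega> assume fin: "wsum 0 V \<omega> < \<infinity>" and \<omega>: "\<omega> \<in> space M" and "(\<Sum>k. ennreal (G k \<omega>)) \<noteq> \<infinity>"
    then have "summable (\<lambda>k. G k \<omega>)"
      by (intro summable_suminf_not_top G_nonneg) auto
    then have "(\<lambda>k. G k \<omega> / dens \<omega>) \<longlonglongrightarrow> 0 / dens \<omega>"
      using dens_pos[OF fin \<omega>] by (intro tendsto_divide summable_LIMSEQ_zero tendsto_const) auto
    then have "(\<lambda>k. (S ((Suc k)\<^sup>2) \<omega> / real ((Suc k)\<^sup>2))\<^sup>2) \<longlonglongrightarrow> 0"
      using dens_pos[OF fin \<omega>] by (simp add: G_def)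
    then have "(\<lambda>k. \<bar>S ((Suc k)\<^sup>2) \<omega> / real ((Suc k)\<^sup>2)\<bar>) \<longlonglongrightarrow> sqrt 0"
      using tendsto_real_sqrt by fastforce
    then have "(\<lambda>k. S ((Suc k)\<^sup>2) \<omega> / real ((Suc k)\<^sup>2)) \<longlonglongrightarrow> 0"
      by (simp only: real_sqrt_zero tendsto_rabs_zero_iff)
    then have "(\<lambda>k. S ((Suc k)\<^sup>2) \<omega> / real ((Suc k)\<^sup>2) + m) \<longlonglongrightarrow> 0 + m"
      by (intro tendsto_add tendsto_const)
    moreover have "S T \<omega> / real T + m = (1 / real T) * (\<Sum>t<T. rsum t f \<omega>)" if "0 < T" for T
      using that by (simp add: S_def sum_subtractf diff_divide_distrib)
    ultimately have "(\<lambda>k. (1 / real ((Suc k)\<^sup>2)) * (\<Sum>t<(Suc k)\<^sup>2. rsum t f \<omega>)) \<longlonglongrightarrow> m"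
      by (simp only: zero_less_power zero_less_Suc add_0_left)
    then show "(\<lambda>T. (1 / real T) * (\<Sum>t<T. rsum t f \<omega>)) \<longlonglongrightarrow> (\<integral>x. f x \<partial>\<mu>)"
      unfolding m_def by (intro averages_converge_if_along_squares rsum_nonneg \<omega> dominatedD(3)[OF f])
  qed
qed

lemma integrable_dominated: "dominated c f \<Longrightarrow> integrable \<mu> f"
  by (rule integrable_sqrt_V[OF prob_\<mu> sets_\<mu> V_\<mu> dominatedD(2,4)])

lemma AE_averages:
  assumes f: "f \<in> borel_measurable X" and f_le: "\<And>x. x \<in> space X \<Longrightarrow> ennreal ((f x)\<^sup>2) \<le> ennreal c * V x"
  shows "AE \<omega> in M. (\<lambda>T. (1 / real T) * (\<Sum>t<T. rsum t f \<omega>)) \<longlonglongrightarrow> (\<integral>x. f x \<partial>\<mu>)"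
proof -
  \<comment> \<open>\<open>dominated\<close> asks for a positive constant, while c may be any real
    number.\<close>
  let ?d = "max 1 c"
  have dom: "dominated ?d (\<lambda>x. max 0 (g x))"
    if [measurable]: "g \<in> borel_measurable X" and g: "\<And>x. x \<in> space X \<Longrightarrow> \<bar>g x\<bar> = \<bar>f x\<bar>" for g
    unfolding dominated_def
  proof (intro conjI ballI)
    fix x assume x: "x \<in> space X"
    have "(max 0 (g x))\<^sup>2 \<le> (f x)\<^sup>2"
      using g[OF x] by (simp add: abs_le_square_iff[symmetric])
    then have "ennreal ((max 0 (g x))\<^sup>2) \<le> ennreal ((f x)\<^sup>2)"
      by (rule ennreal_leI)
    also have "\<dots> \<le> ennreal c * V x" by (rule f_le[OF x])
    also have "\<dots> \<le> ennreal ?d * V x"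
      by (intro mult_right_mono ennreal_leI) auto
    finally show "ennreal ((max 0 (g x))\<^sup>2) \<le> ennreal ?d * V x" .
  qed auto
  have dom_pos: "dominated ?d (\<lambda>x. max 0 (f x))" and dom_neg: "dominated ?d (\<lambda>x. max 0 (- f x))"
    using f by (auto intro!: dom)
  have f_eq: "f = (\<lambda>x. max 0 (f x) - max 0 (- f x))" by auto
  have int_eq: "(\<integral>x. f x \<partial>\<mu>) = (\<integral>x. max 0 (f x) \<partial>\<mu>) - (\<integral>x. max 0 (- f x) \<partial>\<mu>)"
    using Bochner_Integration.integral_diff[OF integrable_dominated[OF dom_pos] integrable_dominated[OF dom_neg]]
    unfolding f_eq[symmetric] .
  have rsum_eq: "rsum t f \<omega> = rsum t (\<lambda>x. max 0 (f x)) \<omega> - rsum t (\<lambda>x. max 0 (- f x)) \<omega>" for t \<omega>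
    unfolding rsum_def sum_subtractf[symmetric] by (intro sum.cong) (auto simp: max_def)
  show ?thesis
    using AE_averages_dominated[OF dom_pos] AE_averages_dominated[OF dom_neg]
    unfolding rsum_eq int_eq sum_subtractf right_diff_distrib
    by eventually_elim (rule tendsto_diff)
qed

end

section \<open>Normalising the rate and closing the circle of implications\<close>

text \<open>The definition bounds \<rho> only from above. At a point with finite V, the bound for g
  = 0 and t = 1 reads 0 <= R \<rho> V(x), so \<rho> >= 0.\<close>

lemma V_uniformly_ergodic_imp_geometric_ergodicity:
  assumes erg: "V_uniformly_ergodic K X \<mu> V" and fin: "\<exists>x\<in>space X. V x < \<infinity>"
  obtains R r where "geometric_ergodicity K X \<mu> V R r"
proof -
  obtain R \<rho> where R: "R > 0" and \<rho>: "\<rho> < 1" and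
    bound: "\<And>g x t. g \<in> borel_measurable X \<Longrightarrow> (\<And>x. x\<in>space X \<Longrightarrow> ennreal \<bar>g x\<bar> \<le> V x) \<Longrightarrow>
      x \<in> space X \<Longrightarrow> V x < \<infinity> \<Longrightarrow>
      \<bar>(\<integral>y. g y \<partial>(kpow K X t x)) - (\<integral>y. g y \<partial>\<mu>)\<bar> \<le> R * \<rho> ^ t * enn2real (V x)"
    using erg unfolding V_uniformly_ergodic_def by blast
  have V: "V \<in> borel_measurable X" "\<And>x. x \<in> space X \<Longrightarrow> 1 \<le> V x" "(\<integral>\<^sup>+ x. V x \<partial>\<mu>) < \<infinity>"
    and K: "K \<in> X \<rightarrow>\<^sub>M prob_algebra X" and \<mu>: "prob_space \<mu>" "sets \<mu> = sets X"
    using erg unfolding V_uniformly_ergodic_def invariant_prob_def by blast+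
  obtain x where x: "x \<in> space X" "V x < \<infinity>" using fin by blast
  have "1 \<le> enn2real (V x)"
    using V(2)[OF x(1)] x(2) by (cases "V x") auto
  moreover have "0 \<le> R * \<rho> * enn2real (V x)"
    using bound[of "\<lambda>_. 0" x 1] x by simp
  ultimately have \<rho>_nonneg: "0 \<le> \<rho>"
    using R by (simp add: zero_le_mult_iff)
  \<comment> \<open>Raising the rate to at least 1/2 keeps it below 1 and makes it strictly
    positive, so the truncation level sqrt (r^t V(x)) is never 0.\<close>
  define r where "r = max \<rho> (1/2)"
  have "geometric_ergodicity K X \<mu> V R r"
  proof (rule geometric_ergodicity.intro)
    fix g x and t :: nat
    assume g: "g \<in> borel_measurable X" "\<And>x. x \<in> space X \<Longrightarrow> ennreal \<bar>g x\<bar> \<le> V x" "x \<in> space X" "V x < \<infinity>"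
    have "\<rho> ^ t \<le> r ^ t"
      using \<rho>_nonneg by (intro power_mono) (auto simp: r_def)
    then have "R * \<rho> ^ t * enn2real (V x) \<le> R * r ^ t * enn2real (V x)"
      using R by (intro mult_right_mono mult_left_mono) auto
    with bound[OF g, of t] show "\<bar>(\<integral>y. g y \<partial>(kpow K X t x)) - (\<integral>y. g y \<partial>\<mu>)\<bar> \<le> R * r ^ t * enn2real (V x)"
      by linarith
  qed (use R \<rho> V K \<mu> in \<open>simp_all add: r_def\<close>)
  then show ?thesis by (rule that)
qed

theorem mainTheorem2:
  fixes M :: "'w measure" and X :: "'a measure" and K :: "'a \<Rightarrow> 'a measure"
    and \<mu>0 \<mu> :: "'a measure" and V :: "'a \<Rightarrow> ennreal" and n0 :: nat
    and F Fh :: "nat \<Rightarrow> 'w measure" and N :: "nat \<Rightarrow> 'w \<Rightarrow> nat"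
    and xi :: "nat \<Rightarrow> nat \<Rightarrow> 'w \<Rightarrow> 'a" and w C :: "nat \<Rightarrow> nat \<Rightarrow> 'w \<Rightarrow> real"
    and Ns par :: "nat \<Rightarrow> nat \<Rightarrow> 'w \<Rightarrow> nat"
  assumes split: "splitting_method M X K \<mu>0 n0 F Fh N xi w C Ns par"
    and erg: "V_uniformly_ergodic K X \<mu> V"
    and V_fin: "emeasure \<mu>0 {x\<in>space X. V x < \<infinity>} = 1"
  shows "((\<forall>\<epsilon>>0. (\<lambda>T::nat. measure M {\<omega>\<in>space M.
              \<bar>(1 / real T) * (\<Sum>t<T. \<Sum>i<N t \<omega>. w t i \<omega>) - 1\<bar> > \<epsilon>}) \<longlonglongrightarrow> 0)
          \<longleftrightarrow> (AE \<omega> in M. \<forall>t. (\<Sum>i<N t \<omega>. w t i \<omega>) = 1))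
       \<and> ((AE \<omega> in M. \<forall>t. (\<Sum>i<N t \<omega>. w t i \<omega>) = 1)
          \<longleftrightarrow> (\<forall>f \<in> borel_measurable X.
                 (\<exists>c::real. \<forall>x\<in>space X. ennreal ((f x)\<^sup>2) \<le> ennreal c * V x) \<longrightarrow>
                 (AE \<omega> in M. (\<lambda>T::nat. (1 / real T) * (\<Sum>t<T. \<Sum>i<N t \<omega>. w t i \<omega> * f (xi t i \<omega>)))
                    \<longlonglongrightarrow> (\<integral>x. f x \<partial>\<mu>))))"
    (is "(?i \<longleftrightarrow> ?ii) \<and> (?ii \<longleftrightarrow> ?iii)")
proof -
  interpret splitting M X K \<mu>0 n0 F Fh N xi w C Ns par
    by (rule splitting.intro[OF split])
  have weight: "(\<Sum>i<N t \<omega>. w t i \<omega>) = weight t \<omega>" for t \<omega>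
    by (simp add: weight_def)
  have "\<exists>x\<in>space X. V x < \<infinity>"
  proof (rule ccontr)
    assume "\<not> ?thesis"
    then have "{x\<in>space X. V x < \<infinity>} = {}" by blast
    then have "emeasure \<mu>0 {x\<in>space X. V x < \<infinity>} = 0" by (simp only: emeasure_empty)
    with V_fin show False by simp
  qed
  from V_uniformly_ergodic_imp_geometric_ergodicity[OF erg this]
  obtain R r where ergodic: "geometric_ergodicity K X \<mu> V R r" .
  interpret geometric_ergodicity K X \<mu> V R r by (rule ergodic)
  have "?i \<Longrightarrow> ?ii"
    unfolding weight AE_all_countable by (intro allI weight_eq_1_if_average_converges) blast
  moreover have "?ii \<Longrightarrow> ?iii"
  proof (intro ballI impI, elim exE)
    fix f c
    assume ?ii and f: "f \<in> borel_measurable X" "\<forall>x\<in>space X. ennreal ((f x)\<^sup>2) \<le> ennreal c * V x"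
    interpret ergodic_splitting M X K \<mu>0 n0 F Fh N xi w C Ns par \<mu> V R r
      by unfold_locales (use V_fin \<open>?ii\<close> in \<open>simp_all add: weight\<close>)
    show "AE \<omega> in M. (\<lambda>T::nat. (1 / real T) * (\<Sum>t<T. \<Sum>i<N t \<omega>. w t i \<omega> * f (xi t i \<omega>))) \<longlonglongrightarrow> (\<integral>x. f x \<partial>\<mu>)"
      using AE_averages[OF f(1), of c] f(2) unfolding rsum_def by blast
  qed
  \<comment> \<open>The constant f = 1 is admissible because V >= 1, and (iii) for it is almost sure
    convergence of the averaged total weight to 1. Dominated convergence for the indicators of the
    deviation events gives convergence in probability.\<close>
  moreover have "?iii \<Longrightarrow> ?i"
  proof (intro allI impI)
    fix \<epsilon> :: real
    assume ?iii and \<epsilon>: "0 < \<epsilon>"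
    define a where "a T \<omega> = (1 / real T) * (\<Sum>t<T. weight t \<omega>)" for T :: nat and \<omega>
    have [measurable]: "a T \<in> borel_measurable M" for T
      unfolding a_def by measurable
    have "\<exists>c::real. \<forall>x\<in>space X. ennreal (1\<^sup>2) \<le> ennreal c * V x"
      by (intro exI[of _ 1]) (auto simp: V_ge_1)
    with \<open>?iii\<close>[rule_format, of "\<lambda>_. 1"]
    have "AE \<omega> in M. (\<lambda>T. a T \<omega>) \<longlonglongrightarrow> 1"
      using prob_space.prob_space[OF prob_\<mu>] by (simp add: a_def weight)
    then have "(\<lambda>T. expectation (indicator {\<omega>\<in>space M. \<bar>a T \<omega> - 1\<bar> > \<epsilon>} :: 'w \<Rightarrow> real)) \<longlonglongrightarrow> expectation (\<lambda>_. 0)"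
    proof (intro integral_dominated_convergence[where w="\<lambda>_. 1"])
      assume "AE \<omega> in M. (\<lambda>T. a T \<omega>) \<longlonglongrightarrow> 1"
      then show "AE \<omega> in M. (\<lambda>T. indicator {\<omega>\<in>space M. \<bar>a T \<omega> - 1\<bar> > \<epsilon>} \<omega> :: real) \<longlonglongrightarrow> 0"
      proof eventually_elim
        case (elim \<omega>)
        then have "\<forall>\<^sub>F T in sequentially. \<bar>a T \<omega> - 1\<bar> < \<epsilon>"
          using tendstoD[OF elim \<epsilon>] by (simp add: dist_real_def)
        then show ?case
          by (intro tendsto_eventually, eventually_elim) (auto simp: indicator_def)
      qed
    qed (auto split: split_indicator)
    then show "(\<lambda>T::nat. measure M {\<omega>\<in>space M.
              \<bar>(1 / real T) * (\<Sum>t<T. \<Sum>i<N t \<omega>. w t i \<omega>) - 1\<bar> > \<epsilon>}) \<longlonglongrightarrow> 0"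
      by (simp add: a_def weight)
  qed
  ultimately show ?thesis by blast
qed

end
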